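(* Let $\alpha\ge 1$. Consider a two-player zero-sum game with positive payoffs $C(i,j)$, in which Player I (the maximizer) has $n$ pure strategies and Player II (the minimizer) has a finite number of pure strategies, at most $2^{p(n)}$ for some polynomial $p$. Assume that there is a polynomial-time (in $n$) $\alpha$-approximate best response oracle and a polynomial-time (in $n$) oracle for evaluating $C(i,j)$. Let $V^*$ be the value of the game. For any $\varepsilon>0$, there exist algorithms that compute mixed strategies $\hat{\mathbf{x}}$ for Player I and $\hat{\mathbf{y}}$ for Player II such that $$C(\mathbf{x},\hat{\mathbf{y}})\le \alpha(1+\varepsilon)V^*\quad\text{for any strategy }\mathbf{x}\text{ of Player I, and}$$ $$C(\hat{\mathbf{x}},\mathbf{y})\ge \frac{V^*}{\alpha(1+\varepsilon)}\quad\text{for any strategy }\mathbf{y}\text{ of Player II.}$$ The algorithm that computes $\hat{\mathbf{y}}$ runs in time polynomial in $n$ and $1/\varepsilon$; the algorithm that computes $\hat{\mathbf{x}}$ runs in time polynomial in $n$, $1/\varepsilon$ and $\alpha$.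
   Context: For mixed strategies (probability vectors) $\mathbf{x}$ of Player I and $\mathbf{y}$ of Player II, $C(\mathbf{x},\mathbf{y})$ denotes the expected payoff; pure strategies are also allowed as arguments. Player I wants to maximize and Player II to minimize the payoff. An $\alpha$-approximate best response oracle is an algorithm, running in time polynomial in $n$, which for any given mixed strategy $\mathbf{x}$ of Player I outputs a pure strategy $j_\alpha(\mathbf{x})$ of Player II such that $C(\mathbf{x},j_\alpha(\mathbf{x}))\le \alpha\min_j C(\mathbf{x},j)$, the minimum being over all pure strategies $j$ of Player II. The payoff-evaluation oracle takes as input (representations of) pure strategies $i$ and $j$ of Players I and II and outputs $C(i,j)$ in time polynomial in $n$. Mixed strategies are represented in sparse form, as a list containing the index of each non-zero entry together with its value. *)

theory Defs
  imports Complex_Main "HOL-Computational_Algebra.Polynomial" "HOL-Library.Log_Nat"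
begin

section \<open>Zero-sum games\<close>

text \<open>Pure strategies are named by natural numbers; \<open>I\<close> and \<open>J\<close> are the finite strategy
  sets of Player I (maximizer) and Player II (minimizer).\<close>

definition mixed :: "nat set \<Rightarrow> (nat \<Rightarrow> real) set" where
  "mixed S = {x. (\<forall>i. 0 \<le> x i) \<and> (\<forall>i. i \<notin> S \<longrightarrow> x i = 0) \<and> sum x S = 1}"

definition pure_strategy :: "nat \<Rightarrow> nat \<Rightarrow> real" where
  "pure_strategy j = (\<lambda>i. if i = j then 1 else 0)"

definition expected_payoff ::
  "nat set \<Rightarrow> nat set \<Rightarrow> (nat \<Rightarrow> nat \<Rightarrow> real) \<Rightarrow> (nat \<Rightarrow> real) \<Rightarrow> (nat \<Rightarrow> real) \<Rightarrow> real" where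
  "expected_payoff I J C x y = (\<Sum>i\<in>I. \<Sum>j\<in>J. x i * y j * C i j)"

text \<open>The value is written as max-min; by the minimax theorem it is also the min-max.\<close>

definition game_value :: "nat set \<Rightarrow> nat set \<Rightarrow> (nat \<Rightarrow> nat \<Rightarrow> real) \<Rightarrow> real" where
  "game_value I J C = (SUP x\<in>mixed I. INF y\<in>mixed J. expected_payoff I J C x y)"

section \<open>Model of computation\<close>

text \<open>
  Algorithms are programs of a WHILE language over binary trees with rational leaves, with a
  logarithmic cost criterion: every evaluation step is charged the length (in bits, up to a
  constant factor) of the value it produces, so operands and results of every operation are
  paid for. Up to polynomial factors this is Turing machine time. A program may call two named
  procedures, whose bodies are again programs, supplied by an environment; a call runs in a
  fresh store and is charged the full running time of the body.
\<close>

datatype val = Num rat | Pair val val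

fun rat_size :: "rat \<Rightarrow> nat" where
  "rat_size q = floorlog 2 (nat \<bar>fst (quotient_of q)\<bar>) + floorlog 2 (nat (snd (quotient_of q)))"

fun val_size :: "val \<Rightarrow> nat" where
  "val_size (Num q) = 1 + rat_size q"
| "val_size (Pair a b) = 1 + val_size a + val_size b"

datatype exp =
    Const val | Var nat
  | MkPair exp exp | Fst exp | Snd exp | IsPair exp
  | Plus exp exp | Minus exp exp | Times exp exp | Divide exp exp | Floor exp | Less exp exp

datatype proc_name = BestResponse | PayoffEval

datatype com =
    Skip | Assign nat exp | Seq com com | If exp com com | While exp com
  | Call nat proc_name exp

type_synonym store = "nat \<Rightarrow> val"

fun num_of :: "val \<Rightarrow> rat" where
  "num_of (Num q) = q"
| "num_of (Pair a b) = 0"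

fun fst_of :: "val \<Rightarrow> val" where
  "fst_of (Num q) = Num 0"
| "fst_of (Pair a b) = a"

fun snd_of :: "val \<Rightarrow> val" where
  "snd_of (Num q) = Num 0"
| "snd_of (Pair a b) = b"

fun is_pair :: "val \<Rightarrow> bool" where
  "is_pair (Num q) = False"
| "is_pair (Pair a b) = True"

fun eval :: "exp \<Rightarrow> store \<Rightarrow> val" where
  "eval (Const v) s = v"
| "eval (Var x) s = s x"
| "eval (MkPair a b) s = Pair (eval a s) (eval b s)"
| "eval (Fst a) s = fst_of (eval a s)"
| "eval (Snd a) s = snd_of (eval a s)"
| "eval (IsPair a) s = Num (if is_pair (eval a s) then 1 else 0)"
| "eval (Plus a b) s = Num (num_of (eval a s) + num_of (eval b s))"
| "eval (Minus a b) s = Num (num_of (eval a s) - num_of (eval b s))"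
| "eval (Times a b) s = Num (num_of (eval a s) * num_of (eval b s))"
| "eval (Divide a b) s = Num (num_of (eval a s) / num_of (eval b s))"
| "eval (Floor a) s = Num (of_int \<lfloor>num_of (eval a s)\<rfloor>)"
| "eval (Less a b) s = Num (if num_of (eval a s) < num_of (eval b s) then 1 else 0)"

fun subexps :: "exp \<Rightarrow> exp list" where
  "subexps (Const v) = [Const v]"
| "subexps (Var x) = [Var x]"
| "subexps (MkPair a b) = MkPair a b # subexps a @ subexps b"
| "subexps (Fst a) = Fst a # subexps a"
| "subexps (Snd a) = Snd a # subexps a"
| "subexps (IsPair a) = IsPair a # subexps a"
| "subexps (Plus a b) = Plus a b # subexps a @ subexps b"
| "subexps (Minus a b) = Minus a b # subexps a @ subexps b"
| "subexps (Times a b) = Times a b # subexps a @ subexps b"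
| "subexps (Divide a b) = Divide a b # subexps a @ subexps b"
| "subexps (Floor a) = Floor a # subexps a"
| "subexps (Less a b) = Less a b # subexps a @ subexps b"

definition exp_cost :: "exp \<Rightarrow> store \<Rightarrow> nat" where
  "exp_cost e s = sum_list (map (\<lambda>a. val_size (eval a s)) (subexps e))"

text \<open>The argument of a program is placed in variable 0, where the result is left as well.\<close>

definition init_store :: "val \<Rightarrow> store" where
  "init_store v = (\<lambda>_. Num 0)(0 := v)"

text \<open>\<open>exec \<Gamma> c s k t\<close>: under the procedure environment \<open>\<Gamma>\<close>, program \<open>c\<close> started in store \<open>s\<close>
  terminates in store \<open>t\<close> in time \<open>k\<close>.\<close>

inductive exec :: "(proc_name \<Rightarrow> com) \<Rightarrow> com \<Rightarrow> store \<Rightarrow> nat \<Rightarrow> store \<Rightarrow> bool"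
  for \<Gamma> :: "proc_name \<Rightarrow> com" where
  Skip: "exec \<Gamma> Skip s 1 s"
| Assign: "exec \<Gamma> (Assign x e) s (1 + exp_cost e s) (s(x := eval e s))"
| Seq: "exec \<Gamma> c1 s k1 s' \<Longrightarrow> exec \<Gamma> c2 s' k2 t \<Longrightarrow> exec \<Gamma> (Seq c1 c2) s (k1 + k2) t"
| IfTrue: "eval e s \<noteq> Num 0 \<Longrightarrow> exec \<Gamma> c1 s k t \<Longrightarrow>
    exec \<Gamma> (If e c1 c2) s (1 + exp_cost e s + k) t"
| IfFalse: "eval e s = Num 0 \<Longrightarrow> exec \<Gamma> c2 s k t \<Longrightarrow>
    exec \<Gamma> (If e c1 c2) s (1 + exp_cost e s + k) t"
| WhileFalse: "eval e s = Num 0 \<Longrightarrow> exec \<Gamma> (While e c) s (1 + exp_cost e s) s"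
| WhileTrue: "eval e s \<noteq> Num 0 \<Longrightarrow> exec \<Gamma> c s k1 s' \<Longrightarrow> exec \<Gamma> (While e c) s' k2 t \<Longrightarrow>
    exec \<Gamma> (While e c) s (1 + exp_cost e s + k1 + k2) t"
| Call: "exec \<Gamma> (\<Gamma> f) (init_store (eval e s)) k t \<Longrightarrow>
    exec \<Gamma> (Call x f e) s (1 + exp_cost e s + k + val_size (t 0)) (s(x := t 0))"

definition computes :: "(proc_name \<Rightarrow> com) \<Rightarrow> com \<Rightarrow> val \<Rightarrow> nat \<Rightarrow> val \<Rightarrow> bool" where
  "computes \<Gamma> c v k w \<longleftrightarrow> (\<exists>t. exec \<Gamma> c (init_store v) k t \<and> t 0 = w)"

lemma exec_deterministic:
  "exec \<Gamma> c s k t \<Longrightarrow> exec \<Gamma> c s k' t' \<Longrightarrow> k = k' \<and> t = t'"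
proof (induction arbitrary: k' t' rule: exec.induct)
  case (Skip s)
  then show ?case by (cases rule: exec.cases) auto
next
  case (Assign x e s)
  then show ?case by (cases rule: exec.cases) auto
next
  case (Seq c1 s k1 s' c2 k2 t)
  from Seq.prems show ?case by (cases rule: exec.cases) (use Seq.IH in blast)+
next
  case (IfTrue e s c1 k t c2)
  from IfTrue.prems show ?case
    by (cases rule: exec.cases) (use IfTrue.hyps IfTrue.IH in blast)+
next
  case (IfFalse e s c2 k t c1)
  from IfFalse.prems show ?case
    by (cases rule: exec.cases) (use IfFalse.hyps IfFalse.IH in blast)+
next
  case (WhileFalse e s c)
  from WhileFalse.prems show ?case
    by (cases rule: exec.cases) (use WhileFalse.hyps in blast)+
next
  case (WhileTrue e s c k1 s' k2 t)
  from WhileTrue.prems show ?case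
    by (cases rule: exec.cases) (use WhileTrue.hyps WhileTrue.IH in blast)+
next
  case (Call f e s k t x)
  from Call.prems show ?case by (cases rule: exec.cases) (use Call.IH in blast)+
qed

corollary computes_deterministic:
  "computes \<Gamma> c v k w \<Longrightarrow> computes \<Gamma> c v k' w' \<Longrightarrow> k = k' \<and> w = w'"
  unfolding computes_def using exec_deterministic by blast

section \<open>Polynomials in several variables\<close>

definition poly2 :: "real poly poly \<Rightarrow> real \<Rightarrow> real \<Rightarrow> real" where
  "poly2 q x y = poly (poly q [:y:]) x"

definition poly3 :: "real poly poly poly \<Rightarrow> real \<Rightarrow> real \<Rightarrow> real \<Rightarrow> real" where
  "poly3 q x y z = poly2 (poly q [:[:z:]:]) x y"

section \<open>Sparse mixed strategies and the two procedures\<close>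

fun encode_sparse :: "(nat \<times> rat) list \<Rightarrow> val" where
  "encode_sparse [] = Num 0"
| "encode_sparse ((i, q) # l) = Pair (Pair (Num (of_nat i)) (Num q)) (encode_sparse l)"

definition represents :: "val \<Rightarrow> (nat \<Rightarrow> real) \<Rightarrow> bool" where
  "represents v x \<longleftrightarrow>
     (\<exists>l. v = encode_sparse l \<and> distinct (map fst l) \<and> fst ` set l = {i. x i \<noteq> 0} \<and>
          (\<forall>(i, q) \<in> set l. x i = real_of_rat q))"

definition payoff_evaluator ::
  "nat set \<Rightarrow> nat set \<Rightarrow> (nat \<Rightarrow> nat \<Rightarrow> real) \<Rightarrow> (proc_name \<Rightarrow> com) \<Rightarrow> real \<Rightarrow> bool" where
  "payoff_evaluator I J C \<Gamma> b \<longleftrightarrow>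
     (\<forall>i\<in>I. \<forall>j\<in>J. \<exists>k q.
        computes \<Gamma> (\<Gamma> PayoffEval) (Pair (Num (of_nat i)) (Num (of_nat j))) k (Num q) \<and>
        real_of_rat q = C i j \<and> real k \<le> b)"

text \<open>The time bound \<open>b\<close> may depend on the length of the representation of the mixed strategy,
  which contains rationals of unbounded bit length and has to be read.\<close>

definition approx_best_responder ::
  "real \<Rightarrow> nat set \<Rightarrow> nat set \<Rightarrow> (nat \<Rightarrow> nat \<Rightarrow> real) \<Rightarrow> (proc_name \<Rightarrow> com) \<Rightarrow> (nat \<Rightarrow> real) \<Rightarrow> bool"
where
  "approx_best_responder \<alpha> I J C \<Gamma> b \<longleftrightarrow>
     (\<forall>x\<in>mixed I. \<forall>v. represents v x \<longrightarrow>
        (\<exists>k j. computes \<Gamma> (\<Gamma> BestResponse) v k (Num (of_nat j)) \<and> j \<in> J \<and>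
           expected_payoff I J C x (pure_strategy j)
             \<le> \<alpha> * Min ((\<lambda>j'. expected_payoff I J C x (pure_strategy j')) ` J) \<and>
           real k \<le> b (val_size v)))"

text \<open>The solvers are given \<open>n\<close> and the accuracy \<open>\<epsilon>\<close>; a real \<open>\<epsilon> > 0\<close> is presented to them as the
  integer \<open>\<lceil>1/\<epsilon>\<rceil>\<close>, whose length is bounded in terms of \<open>1/\<epsilon>\<close>.\<close>

definition solver_input :: "nat \<Rightarrow> real \<Rightarrow> val" where
  "solver_input n \<epsilon> = Pair (Num (of_nat n)) (Num (of_int \<lceil>1 / \<epsilon>\<rceil>))"

end

(* Player I keeps multiplicative weights on the rows. In every round the oracle answers the normalized
   weights x with a column j, which is played with step size delta = 1 / max_i C(i,j), and the weight
   of row i is multiplied by 1 + C(i,j) delta / H for H = 2 (N + 1), N = ceiling (1/eps). Every round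
   raises the accumulated load sum delta C(i,j) of some row by one, so after n^2 H^2 rounds the
   largest load is at least n H^2 >= H^2 ln n, and comparing it with the sum of the weights bounds it
   by (1 + eps) sum delta C(x,j). Hence the normalized combination of the columns guarantees Player II
   the factor alpha (1 + eps), and the best x among the rounds guarantees the same factor to Player I;
   in particular neither the minimax theorem nor knowledge of alpha is needed.
   The weights are exact rationals: a round multiplies them by factors whose length is bounded by
   those of the payoffs, so all lengths stay polynomial. *)

theory Submission
  imports Defs
begin

text \<open>With a fixed step size the number of rounds would depend on the width, the largest
  payoff relative to the value, which can be exponential in n. The step 1 / \<open>M j\<close> fixes
  the progress per round instead, as in width-independent algorithms for fractional packing. H comes
  from two losses of a fraction 1 / H: one in replacing 1 + z by an exponential, one in absorbing ln
  n. Together they leave 1 - 2 / H = N / (N + 1), whose inverse 1 + 1 / N is at most 1 + \<epsilon>.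
  The lengths of payoffs and of column names are bounded by the running times of the procedures that
  output them, because writing a value costs at least its length. The bounds are fixed in an order
  that avoids a circle: the payoff evaluator bounds all rationals, these bound the query to the best
  response procedure, the query bounds the time of a call, and rationals and calls together bound
  the store.\<close>

section \<open>Bit lengths\<close>

text \<open>Unlike \<^const>\<open>rat_size\<close>, the maximum of the two lengths is subadditive under all field
  operations up to an additive constant, so that it can be iterated.\<close>

definition bits :: "rat \<Rightarrow> nat" where
  "bits q = max (floorlog 2 (nat \<bar>fst (quotient_of q)\<bar>)) (floorlog 2 (nat (snd (quotient_of q))))"

lemma bits_fracE:
  obtains p d where "q = of_int p / of_int d" "d > 0" "\<bar>p\<bar> < 2 ^ bits q" "d < 2 ^ bits q"
    "coprime p d" "quotient_of q = (p, d)"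
proof -
  obtain p d where pd: "quotient_of q = (p, d)" by (cases "quotient_of q")
  have d: "d > 0" using quotient_of_denom_pos[OF pd] .
  have *: "nat \<bar>p\<bar> < 2 ^ bits q" "nat d < 2 ^ bits q"
    unfolding bits_def pd by (rule floorlog_leD; simp)+
  have "\<bar>p\<bar> < 2 ^ bits q" "d < 2 ^ bits q"
    using * d by (simp_all add: nat_less_iff)
  then show ?thesis
    using that pd d quotient_of_div[OF pd] quotient_of_coprime[OF pd] by blast
qed

lemma bits_pos: "bits q \<ge> 1"
proof -
  obtain p d where "(d::int) > 0" "d < 2 ^ bits q" by (rule bits_fracE[of q])
  then show ?thesis by (cases "bits q") auto
qed

text \<open>Cancelling common factors only shrinks numerator and denominator, so any fraction
  representing the number bounds its length. The arithmetic bounds below therefore never have to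
  reduce a fraction.\<close>

lemma bits_frac_le:
  assumes "d \<noteq> 0" "\<bar>p\<bar> < 2 ^ b" "\<bar>d\<bar> < 2 ^ b"
  shows "bits (of_int p / of_int d) \<le> b"
proof -
  let ?q = "of_int p / of_int d :: rat"
  obtain p' d' where q: "?q = of_int p' / of_int d'" "d' > 0" "coprime p' d'"
    and quo: "quotient_of ?q = (p', d')" by (rule bits_fracE[of ?q])
  from q(1) assms(1) q(2) have "(of_int (p * d') :: rat) = of_int (p' * d)"
    by (simp add: field_simps)
  then have eq: "p * d' = p' * d" by (simp only: of_int_eq_iff)
  have "p' dvd p" using q(3) eq by (metis coprime_dvd_mult_left_iff dvd_triv_left)
  have "d' dvd d" using q(3) eq
    by (metis coprime_commute coprime_dvd_mult_right_iff dvd_triv_right)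
  then have "\<bar>d'\<bar> \<le> \<bar>d\<bar>" using assms(1) by (simp add: dvd_imp_le_int)
  moreover have "\<bar>p'\<bar> \<le> \<bar>p\<bar>"
  proof (cases "p = 0")
    case True
    then show ?thesis using eq assms(1) by simp
  qed (use \<open>p' dvd p\<close> dvd_imp_le_int in auto)
  ultimately have "\<bar>p'\<bar> < 2 ^ b" "d' < 2 ^ b" using assms q(2) by linarith+
  then have "floorlog 2 (nat \<bar>p'\<bar>) \<le> b" "floorlog 2 (nat d') \<le> b"
    using q(2) by (intro floorlog_leI; simp add: nat_less_iff)+
  then show ?thesis unfolding bits_def quo by simp
qed

text \<open>Over the common denominator the new numerator combines two products; the extra bit pays
  for adding them.\<close>

lemma bits_add_diff:
  "bits (x + y) \<le> bits x + bits y + 1" "bits (x - y) \<le> bits x + bits y + 1"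
proof -
  obtain p d where x: "x = of_int p / of_int d" "d > 0" "\<bar>p\<bar> < 2 ^ bits x" "d < 2 ^ bits x"
    by (rule bits_fracE[of x])
  obtain r e where y: "y = of_int r / of_int e" "e > 0" "\<bar>r\<bar> < 2 ^ bits y" "e < 2 ^ bits y"
    by (rule bits_fracE[of y])
  have s: "x + y = of_int (p * e + r * d) / of_int (d * e)"
    "x - y = of_int (p * e - r * d) / of_int (d * e)"
    by (subst x(1), subst y(1), use x(2) y(2) in \<open>simp add: add_frac_eq diff_frac_eq\<close>)+
  have mono: "\<bar>u * v\<bar> < 2 ^ (bits x + bits y)" if "\<bar>u\<bar> < 2 ^ bits x" "\<bar>v\<bar> < 2 ^ bits y" for u v :: int
    using mult_strict_mono'[OF that] by (simp add: abs_mult power_add)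
  have 1: "\<bar>p * e\<bar> < 2 ^ (bits x + bits y)" "\<bar>d * r\<bar> < 2 ^ (bits x + bits y)"
    "\<bar>d * e\<bar> < 2 ^ (bits x + bits y)"
    using x y by (intro mono; simp)+
  have 2: "\<bar>p * e + r * d\<bar> < 2 ^ (bits x + bits y + 1)" "\<bar>p * e - r * d\<bar> < 2 ^ (bits x + bits y + 1)"
    "\<bar>d * e\<bar> < 2 ^ (bits x + bits y + 1)" "d * e \<noteq> 0"
    using 1 x(2) y(2) mult.commute[of d r] by (auto simp del: abs_mult)
  show "bits (x + y) \<le> bits x + bits y + 1" "bits (x - y) \<le> bits x + bits y + 1"
    unfolding s by (intro bits_frac_le 2)+
qed

lemma bits_mult: "bits (x * y) \<le> bits x + bits y"
proof -
  obtain p d where x: "x = of_int p / of_int d" "d > 0" "\<bar>p\<bar> < 2 ^ bits x" "d < 2 ^ bits x"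
    by (rule bits_fracE[of x])
  obtain r e where y: "y = of_int r / of_int e" "e > 0" "\<bar>r\<bar> < 2 ^ bits y" "e < 2 ^ bits y"
    by (rule bits_fracE[of y])
  have s: "x * y = of_int (p * r) / of_int (d * e)" using x y by simp
  have "\<bar>p * r\<bar> < 2 ^ (bits x + bits y)" "\<bar>d * e\<bar> < 2 ^ (bits x + bits y)"
    using x y mult_strict_mono'[of "\<bar>p\<bar>" "2 ^ bits x" "\<bar>r\<bar>" "2 ^ bits y"]
      mult_strict_mono'[of d "2 ^ bits x" e "2 ^ bits y"]
    by (simp_all add: abs_mult power_add)
  then show ?thesis unfolding s by (intro bits_frac_le) (use x y in simp_all)
qed

lemma bits_inverse: "bits (inverse x) \<le> bits x"
proof -
  obtain p d where x: "x = of_int p / of_int d" "d > 0" "\<bar>p\<bar> < 2 ^ bits x" "d < 2 ^ bits x"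
    by (rule bits_fracE[of x])
  show ?thesis
  proof (cases "p = 0")
    case True
    then show ?thesis using x by simp
  next
    case False
    have "inverse x = of_int d / of_int p" using x by simp
    then show ?thesis using bits_frac_le[of p d "bits x"] False x by simp
  qed
qed

lemma bits_divide: "bits (x / y) \<le> bits x + bits y"
  using bits_mult[of x "inverse y"] bits_inverse[of y] by (simp add: divide_inverse)

lemma bits_of_int: "\<bar>p\<bar> < 2 ^ b \<Longrightarrow> b \<ge> 1 \<Longrightarrow> bits (of_int p) \<le> b"
  using bits_frac_le[of 1 p b] one_less_power[of "2::int" b] by simp

text \<open>Linear in k instead of logarithmic, which is enough for row indices, counters and the
  parameters n, H, T: their values are polynomial already. Column indices may be exponentially large
  and are bounded by the oracle's running time instead.\<close>

lemma bits_of_nat: "bits (of_nat k) \<le> k + 1"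
proof -
  have "int k < 2 ^ (k + 1)"
    using of_nat_less_two_power[of k, where 'a = int]
    by (rule less_le_trans) (simp add: power_increasing)
  then show ?thesis using bits_of_int[of "int k" "k + 1"] by simp
qed

lemma bits_0_1 [simp]: "bits 0 = 1" "bits 1 = 1"
  by (simp_all add: bits_def floorlog_def)

lemma bits_floor: "bits (of_int \<lfloor>x\<rfloor>) \<le> bits x"
proof -
  obtain p d where x: "x = of_int p / of_int d" "d > 0" "\<bar>p\<bar> < 2 ^ bits x" "d < 2 ^ bits x"
    by (rule bits_fracE[of x])
  have "\<lfloor>x\<rfloor> = p div d" using x by (simp add: floor_divide_of_int_eq)
  moreover have "\<bar>p div d\<bar> \<le> \<bar>p\<bar>"
  proof (cases "p \<ge> 0")
    case True
    then have "0 \<le> p div d" "p div d \<le> p"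
      using x(2) by (simp_all add: pos_imp_zdiv_nonneg_iff zdiv_mono2[of p 1 d, simplified])
    then show ?thesis using True by simp
  next
    case False
    have "p div d < 0" using False x(2) by (simp add: div_neg_pos_less0)
    \<comment> \<open>Rounding down moves a negative quotient away from zero, but
      \<open>p * d \<le> p\<close> keeps it at or above p.\<close>
    moreover have "p \<le> p div d"
    proof -
      have "p * d \<le> p" using False x(2) mult_left_mono_neg[of 1 d p] by simp
      then have "(p * d) div d \<le> p div d" using x(2) by (intro zdiv_mono1) auto
      then show ?thesis using x(2) by simp
    qed
    ultimately show ?thesis using False by linarith
  qed
  ultimately show ?thesis using bits_of_int[of "\<lfloor>x\<rfloor>" "bits x"] x(3) bits_pos[of x] by linarith
qed

lemma rat_size_le_bits: "rat_size q \<le> 2 * bits q"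
  and bits_le_rat_size: "bits q \<le> rat_size q"
  by (simp_all add: bits_def)

lemma val_size_Num_le: "val_size (Num q) \<le> 2 * bits q + 1"
  using rat_size_le_bits[of q] by simp

lemma bits_sum_list:
  assumes "\<And>i. i \<in> set is \<Longrightarrow> bits (f i) \<le> b"
  shows "bits (\<Sum>i\<leftarrow>is. f i) \<le> length is * (b + 1) + 1"
  using assms
proof (induction "is")
  case (Cons i "is")
  have "bits (f i + (\<Sum>i\<leftarrow>is. f i)) \<le> bits (f i) + bits (\<Sum>i\<leftarrow>is. f i) + 1"
    by (rule bits_add_diff)
  also have "\<dots> \<le> b + (length is * (b + 1) + 1) + 1"
    using Cons by (intro add_mono) simp_all
  finally show ?case by simp
qed simp

section \<open>Cost bounds for programs\<close>

text \<open>Lengths are subadditive under arithmetic, so in a store of values of size at most B the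
  value of an expression has size linear in B, with a factor depending on the expression alone. The
  factors 2 come from converting between \<open>bits\<close> and \<open>val_size\<close>, the 2 for
  projections from the default value \<open>Num 0\<close> of size 2.\<close>

fun eval_factor :: "exp \<Rightarrow> nat" where
  "eval_factor (Const v) = val_size v"
| "eval_factor (Var x) = 1"
| "eval_factor (MkPair a b) = 1 + eval_factor a + eval_factor b"
| "eval_factor (Fst a) = eval_factor a + 2"
| "eval_factor (Snd a) = eval_factor a + 2"
| "eval_factor (IsPair a) = 3"
| "eval_factor (Plus a b) = 3 + 2 * eval_factor a + 2 * eval_factor b"
| "eval_factor (Minus a b) = 3 + 2 * eval_factor a + 2 * eval_factor b"
| "eval_factor (Times a b) = 3 + 2 * eval_factor a + 2 * eval_factor b"
| "eval_factor (Divide a b) = 3 + 2 * eval_factor a + 2 * eval_factor b"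
| "eval_factor (Floor a) = 3 + 2 * eval_factor a"
| "eval_factor (Less a b) = 3"

definition cost_factor :: "exp \<Rightarrow> nat" where
  "cost_factor e = sum_list (map eval_factor (subexps e))"

definition sized :: "nat \<Rightarrow> store \<Rightarrow> bool" where
  "sized B s \<longleftrightarrow> (\<forall>x. val_size (s x) \<le> B)"

lemma sized_upd: "sized B s \<Longrightarrow> val_size v \<le> B \<Longrightarrow> sized B (s(x := v))"
  by (simp add: sized_def)

lemma val_size_01: "val_size (Num 0) = 2" "val_size (Num 1) = 3"
  by (simp_all add: floorlog_def)

lemma val_size_fst_snd: "val_size (fst_of v) \<le> val_size v + 2" "val_size (snd_of v) \<le> val_size v + 2"
  by (cases v; simp add: floorlog_def)+

lemma bits_num_of: "bits (num_of v) \<le> val_size v"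
  using bits_le_rat_size by (cases v) (auto intro: le_SucI)

lemma val_size_arith:
  assumes "bits q \<le> bits (num_of v) + bits (num_of w) + 1"
  shows "val_size (Num q) \<le> 3 + 2 * val_size v + 2 * val_size w"
  using assms val_size_Num_le[of q] bits_num_of[of v] bits_num_of[of w] by linarith

lemma val_size_eval_le:
  assumes "sized B s" "B \<ge> 1"
  shows "val_size (eval e s) \<le> eval_factor e * B"
proof -
  have 3: "3 \<le> 3 * B" and 2: "2 \<le> 2 * B" and 1: "1 \<le> B" using assms(2) by simp_all
  have arith: "3 + 2 * a + 2 * b \<le> (3 + 2 * f + 2 * g) * B" if "a \<le> f * B" "b \<le> g * B" for a b f g
    using 3 that by (simp add: add_mult_distrib)
  show ?thesis
  proof (induction e)
    case (Const v)
    then show ?case using assms(2) by simp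
  next
    case (Var x)
    then show ?case using assms(1) by (simp add: sized_def)
  next
    case (Fst e)
    then show ?case using val_size_fst_snd(1)[of "eval e s"] 2
      by (simp add: add_mult_distrib)
  next
    case (Snd e)
    then show ?case using val_size_fst_snd(2)[of "eval e s"] 2
      by (simp add: add_mult_distrib)
  next
    case (MkPair a b)
    then show ?case using 1 by (simp add: add_mult_distrib)
  next
    case (IsPair e)
    then show ?case using 3 by (simp add: val_size_01 del: val_size.simps)
  next
    case (Less a b)
    then show ?case using 3 by (simp add: val_size_01 del: val_size.simps)
  next
    case (Plus a b)
    show ?case
      using arith[OF Plus] val_size_arith[OF bits_add_diff(1), of "eval a s" "eval b s"]
      by (simp del: val_size.simps)
  next
    case (Minus a b)
    show ?case
      using arith[OF Minus] val_size_arith[OF bits_add_diff(2), of "eval a s" "eval b s"]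
      by (simp del: val_size.simps)
  next
    case (Times a b)
    show ?case
      using arith[OF Times] val_size_arith[OF le_trans[OF bits_mult le_add1], of "eval a s" "eval b s"]
      by (simp del: val_size.simps)
  next
    case (Divide a b)
    show ?case
      using arith[OF Divide] val_size_arith[OF le_trans[OF bits_divide le_add1], of "eval a s" "eval b s"]
      by (simp del: val_size.simps)
  next
    case (Floor e)
    have "val_size (eval (Floor e) s) \<le> 2 * val_size (eval e s) + 1"
      using val_size_Num_le[of "of_int \<lfloor>num_of (eval e s)\<rfloor>"]
        bits_floor[of "num_of (eval e s)"] bits_num_of[of "eval e s"]
      by (simp del: val_size.simps)
    then show ?case using Floor 3 by (simp add: add_mult_distrib del: val_size.simps)
  qed
qed

lemma exp_cost_le:
  assumes "sized B s" "B \<ge> 1"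
  shows "exp_cost e s \<le> cost_factor e * B"
proof -
  have "exp_cost e s \<le> (\<Sum>a\<leftarrow>subexps e. eval_factor a * B)"
    unfolding exp_cost_def by (intro sum_list_mono val_size_eval_le assms)
  then show ?thesis by (simp add: cost_factor_def sum_list_mult_const)
qed

text \<open>A value that is written has been paid for, hence a variable is either untouched or no
  longer than the running time. This turns time bounds on the procedures into length bounds on their
  answers.\<close>

lemma exec_size: "exec \<Gamma> c s k t \<Longrightarrow> t x = s x \<or> val_size (t x) \<le> k"
proof (induction rule: exec.induct)
  case (Assign y e s)
  have "val_size (eval e s) \<le> exp_cost e s"
    unfolding exp_cost_def by (cases e) simp_all
  then show ?case by auto
next
  case (Call f e s k t y)
  then show ?case by auto
qed auto

text \<open>Every list in the programs below pairs the elements of an index list with their values.\<close>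

definition enc :: "(nat \<Rightarrow> rat) \<Rightarrow> nat list \<Rightarrow> val" where
  "enc f is = encode_sparse (map (\<lambda>i. (i, f i)) is)"

lemma enc_simps [simp]:
  "enc f [] = Num 0"
  "enc f (i # is) = Pair (Pair (Num (of_nat i)) (Num (f i))) (enc f is)"
  by (simp_all add: enc_def)

text \<open>The body finds the current entry in variable 9 and the remaining list in 8. The end is
  recognized because the empty list \<open>Num 0\<close> is not a pair.\<close>

definition foreach :: "exp \<Rightarrow> com \<Rightarrow> com" where
  "foreach e c = Seq (Assign 8 e) (While (IsPair (Var 8))
     (Seq (Assign 9 (Fst (Var 8))) (Seq (Assign 8 (Snd (Var 8))) c)))"

text \<open>A program started in \<open>s\<close> terminates within \<open>m\<close> time units of length \<open>1000 B + R\<close> in a store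
  satisfying \<open>P\<close>. A unit pays for one elementary instruction of the programs below in a store of
  values of size at most \<open>B\<close>, including a procedure call of cost \<open>R\<close>.\<close>

locale machine =
  fixes \<Gamma> :: "proc_name \<Rightarrow> com" and B R :: nat
  assumes B_ge: "B \<ge> 3"
begin

definition wp :: "com \<Rightarrow> store \<Rightarrow> nat \<Rightarrow> (store \<Rightarrow> bool) \<Rightarrow> bool" where
  "wp c s m P \<longleftrightarrow> (\<exists>k t. exec \<Gamma> c s k t \<and> k \<le> m * (1000 * B + R) \<and> P t)"

text \<open>Of the 1000 B of a unit at most 900 B go into evaluating the expression; the rest covers
  the constant 1 and the returned value that a call is charged for.\<close>

lemma exp_cost_unit:
  "sized B s \<Longrightarrow> cost_factor e \<le> 900 \<Longrightarrow> 1 + exp_cost e s + B \<le> 1000 * B"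
proof -
  assume *: "sized B s" "cost_factor e \<le> 900"
  have "exp_cost e s \<le> cost_factor e * B" using *(1) B_ge by (intro exp_cost_le) simp_all
  also have "\<dots> \<le> 900 * B" using *(2) by simp
  finally show ?thesis using B_ge by simp
qed

lemma wp_conseq:
  "wp c s m P \<Longrightarrow> m \<le> m' \<Longrightarrow> (\<And>t. P t \<Longrightarrow> P' t) \<Longrightarrow> wp c s m' P'"
  unfolding wp_def by (meson le_trans mult_le_mono1)

lemma wp_Skip: "P s \<Longrightarrow> wp Skip s 1 P"
proof -
  assume "P s"
  moreover have "1 \<le> 1 * (1000 * B + R)" using B_ge by simp
  ultimately show ?thesis unfolding wp_def using exec.Skip by blast
qed

lemma wp_Assign:
  assumes "sized B s" "cost_factor e \<le> 900" "P (s(x := eval e s))"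
  shows "wp (Assign x e) s 1 P"
proof -
  have "1 + exp_cost e s \<le> 1 * (1000 * B + R)" using exp_cost_unit[OF assms(1,2)] by simp
  then show ?thesis unfolding wp_def using exec.Assign assms(3) by blast
qed

lemma wp_Seq:
  assumes "wp c1 s m1 (\<lambda>t. wp c2 t m2 P)"
  shows "wp (Seq c1 c2) s (m1 + m2) P"
proof -
  obtain k1 t1 k2 t2 where *: "exec \<Gamma> c1 s k1 t1" "k1 \<le> m1 * (1000 * B + R)"
    "exec \<Gamma> c2 t1 k2 t2" "k2 \<le> m2 * (1000 * B + R)" "P t2"
    using assms unfolding wp_def by blast
  have "k1 + k2 \<le> (m1 + m2) * (1000 * B + R)" using *(2,4) by (simp add: add_mult_distrib)
  then show ?thesis unfolding wp_def using exec.Seq * by blast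
qed

lemma wp_If:
  assumes "sized B s" "cost_factor e \<le> 900"
    and "eval e s \<noteq> Num 0 \<Longrightarrow> wp c1 s m P" "eval e s = Num 0 \<Longrightarrow> wp c2 s m P"
  shows "wp (If e c1 c2) s (1 + m) P"
proof -
  have e: "1 + exp_cost e s \<le> 1000 * B + R" using exp_cost_unit[OF assms(1,2)] by simp
  have "\<exists>k t. exec \<Gamma> (If e c1 c2) s (1 + exp_cost e s + k) t \<and> k \<le> m * (1000 * B + R) \<and> P t"
    using assms(3,4) exec.IfTrue exec.IfFalse unfolding wp_def by metis
  then obtain k t where "exec \<Gamma> (If e c1 c2) s (1 + exp_cost e s + k) t"
    "k \<le> m * (1000 * B + R)" "P t" by blast
  moreover from this e have "1 + exp_cost e s + k \<le> (1 + m) * (1000 * B + R)"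
    by (simp add: add_mult_distrib)
  ultimately show ?thesis unfolding wp_def by blast
qed

lemma wp_While_False:
  assumes "sized B s" "cost_factor e \<le> 900" "eval e s = Num 0" "P s"
  shows "wp (While e c) s 1 P"
proof -
  have "1 + exp_cost e s \<le> 1 * (1000 * B + R)" using exp_cost_unit[OF assms(1,2)] by simp
  then show ?thesis unfolding wp_def using exec.WhileFalse assms(3,4) by blast
qed

lemma wp_While_True:
  assumes "sized B s" "cost_factor e \<le> 900" "eval e s \<noteq> Num 0"
    and "wp c s m1 (\<lambda>t. wp (While e c) t m2 P)"
  shows "wp (While e c) s (1 + m1 + m2) P"
proof -
  have e: "1 + exp_cost e s \<le> 1000 * B + R" using exp_cost_unit[OF assms(1,2)] by simp
  obtain k1 t1 k2 t2 where *: "exec \<Gamma> c s k1 t1" "k1 \<le> m1 * (1000 * B + R)"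
    "exec \<Gamma> (While e c) t1 k2 t2" "k2 \<le> m2 * (1000 * B + R)" "P t2"
    using assms(4) unfolding wp_def by blast
  have "1 + exp_cost e s + k1 + k2 \<le> (1 + m1 + m2) * (1000 * B + R)"
    using *(2,4) e by (simp add: add_mult_distrib)
  then show ?thesis unfolding wp_def using exec.WhileTrue * assms(3) by blast
qed

lemma wp_Call:
  assumes "sized B s" "cost_factor e \<le> 900"
    and "computes \<Gamma> (\<Gamma> f) (eval e s) k v" "k \<le> R" "val_size v \<le> B" "P (s(x := v))"
  shows "wp (Call x f e) s 1 P"
proof -
  obtain t where t: "exec \<Gamma> (\<Gamma> f) (init_store (eval e s)) k t" "t 0 = v"
    using assms(3) unfolding computes_def by blast
  have "1 + exp_cost e s + k + val_size (t 0) \<le> 1 * (1000 * B + R)"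
    using exp_cost_unit[OF assms(1,2)] assms(4,5) t(2) by simp
  then show ?thesis unfolding wp_def using exec.Call[OF t(1)] assms(6) t(2) by blast
qed

text \<open>The invariant is indexed by the prefix already traversed and must survive the loop's own
  writes to 8 and 9. Each entry costs the test, two assignments and the body; the initial assignment
  and the last test give the summand 2.\<close>

lemma wp_foreach:
  assumes "sized B s" "cost_factor e \<le> 900" "eval e s = enc f is"
    and "val_size (enc f is) \<le> B"
    and step: "\<And>pre i rest t. is = pre @ i # rest \<Longrightarrow> Inv pre t \<Longrightarrow> sized B t \<Longrightarrow>
        t 9 = Pair (Num (of_nat i)) (Num (f i)) \<Longrightarrow> 
        wp c t m (\<lambda>t'. Inv (pre @ [i]) t' \<and> t' 8 = t 8 \<and> sized B t')"
    and upd: "\<And>pre t u v. Inv pre t \<Longrightarrow> Inv pre (t(8 := u, 9 := v))"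
    and init: "Inv [] s"
  shows "wp (foreach e c) s (2 + length is * (m + 3)) (\<lambda>t. Inv is t \<and> sized B t)"
proof -
  \<comment> \<open>The assumption \<open>upd\<close> changes 8 and 9 together; rewriting 9 with its
    own value yields the single update \<open>upd8\<close> needed on entry.\<close>
  let ?b = "Seq (Assign 9 (Fst (Var 8))) (Seq (Assign 8 (Snd (Var 8))) c)"
  let ?w = "While (IsPair (Var 8)) ?b"
  have upd8: "Inv pre (t(8 := u))" if "Inv pre t" for pre t u
  proof -
    have "t(8 := u, 9 := t 9) = t(8 := u)" by auto
    then show ?thesis using upd[OF that, of u "t 9"] by simp
  qed
  have fac: "cost_factor (IsPair (Var 8)) \<le> 900" "cost_factor (Fst (Var 8)) \<le> 900"
    "cost_factor (Snd (Var 8)) \<le> 900"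
    by (simp_all add: cost_factor_def)
  have loop: "wp ?w t (1 + length rest * (m + 3)) (\<lambda>t. Inv is t \<and> sized B t)"
    if "is = pre @ rest" "Inv pre t" "t 8 = enc f rest" "sized B t" for pre rest t
    using that
  proof (induction rest arbitrary: "pre" t)
    case Nil
    then show ?case
      using wp_While_False[OF Nil.prems(4) fac(1), of "\<lambda>t. Inv is t \<and> sized B t"] by simp
  next
    case (Cons i rest)
    let ?t = "t(9 := Pair (Num (of_nat i)) (Num (f i)), 8 := enc f rest)"
    have t8: "t 8 = Pair (Pair (Num (of_nat i)) (Num (f i))) (enc f rest)"
      using Cons.prems(3) by simp
    have "val_size (t 8) \<le> B" using Cons.prems(4) by (simp add: sized_def)
    then have sz: "sized B (t(9 := Pair (Num (of_nat i)) (Num (f i))))" "sized B ?t"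
      unfolding t8 by (intro sized_upd Cons.prems(4); simp)+
    have "Inv pre ?t"
      using upd[OF Cons.prems(2)] by (subst fun_upd_twist) simp_all
    then have "wp c ?t m (\<lambda>t'. Inv (pre @ [i]) t' \<and> t' 8 = ?t 8 \<and> sized B t')"
      using Cons.prems(1) sz(2) by (intro step) simp_all
    then have body: "wp c ?t m (\<lambda>t'. wp ?w t' (1 + length rest * (m + 3)) (\<lambda>t. Inv is t \<and> sized B t))"
      by (rule wp_conseq) (use Cons.IH[of "pre @ [i]"] Cons.prems(1) in auto)
    have "wp ?b t (1 + (1 + m)) (\<lambda>t'. wp ?w t' (1 + length rest * (m + 3)) (\<lambda>t. Inv is t \<and> sized B t))"
      by (intro wp_Seq wp_Assign fac Cons.prems(4)) (use body sz t8 in simp_all)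
    then have "wp ?w t (1 + (1 + (1 + m)) + (1 + length rest * (m + 3))) (\<lambda>t. Inv is t \<and> sized B t)"
      by (intro wp_While_True fac Cons.prems(4)) (use t8 in simp_all)
    then show ?case by (rule wp_conseq) simp_all
  qed
  have "wp ?w (s(8 := enc f is)) (1 + length is * (m + 3)) (\<lambda>t. Inv is t \<and> sized B t)"
    using assms(1,4) upd8[OF init] by (intro loop[of "[]"] sized_upd) simp_all
  then have "wp (foreach e c) s (1 + (1 + length is * (m + 3))) (\<lambda>t. Inv is t \<and> sized B t)"
    unfolding foreach_def
    by (intro wp_Seq wp_Assign assms(1,2)) (use assms(3) in simp)
  then show ?thesis by simp
qed

end

section \<open>Multiplicative weights with normalized columns\<close>

text \<open>Reduces to ln (1 + z) >= z - z^2 >= z (1 - \<eta>). The factor z / \<eta> is kept apart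
  because with \<eta> = 1 / H and z = \<open>c i j / (M j * H)\<close> it is the increase of the
  load of row i.\<close>

lemma one_plus_ge_exp:
  fixes z \<eta> :: real
  assumes "0 \<le> z" "z \<le> \<eta>" "\<eta> \<le> 1"
  shows "exp (\<eta> * (1 - \<eta>) * (z / \<eta>)) \<le> 1 + z"
proof (cases "\<eta> = 0")
  case False
  have "z * z \<le> z * \<eta>" using assms by (intro mult_left_mono)
  then have "z * (1 - \<eta>) \<le> z - z\<^sup>2" by (simp add: power2_eq_square algebra_simps)
  also have "\<dots> \<le> ln (1 + z)" using assms by (intro ln_one_plus_pos_lower_bound) simp_all
  finally have "exp (z * (1 - \<eta>)) \<le> 1 + z" using assms by (simp add: ln_ge_iff[symmetric] del: exp_le_cancel_iff)
  then show ?thesis using False by (simp add: mult.commute)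
qed (use assms in simp)

text \<open>A history lists the columns played so far, latest first. Column \<open>j\<close> is played with step
  size \<open>1 / M j\<close>, so that every round increases the load of some row by exactly one; this makes
  the number of rounds independent of the magnitude of the payoffs.\<close>

locale mw =
  fixes n H :: nat and J :: "nat set" and c :: "nat \<Rightarrow> nat \<Rightarrow> rat"
  assumes n_pos: "n \<ge> 1" and H_ge: "H \<ge> 2"
    and c_pos: "\<And>i j. i < n \<Longrightarrow> j \<in> J \<Longrightarrow> c i j > 0"
begin

text \<open>With 1 / \<open>M j\<close> as the step size, \<open>L js i\<close> is the load of row
  i, \<open>Y js\<close> normalized by its total \<open>D js\<close> is the strategy of Player II,
  and \<open>A js\<close> below accumulates the load expected under the strategy that Player I held
  in each round. Player I's strategy after the history \<open>js\<close> is \<open>X js\<close>, and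
  \<open>V js j\<close> is its payoff against column j.\<close>

definition M :: "nat \<Rightarrow> rat" where "M j = Max ((\<lambda>i. c i j) ` {..<n})"
definition W :: "nat list \<Rightarrow> nat \<Rightarrow> rat" where
  "W js i = (\<Prod>j\<leftarrow>js. 1 + c i j / (M j * of_nat H))"
definition S :: "nat list \<Rightarrow> rat" where "S js = (\<Sum>i<n. W js i)"
definition X :: "nat list \<Rightarrow> nat \<Rightarrow> rat" where "X js i = W js i / S js"
definition V :: "nat list \<Rightarrow> nat \<Rightarrow> rat" where "V js j = (\<Sum>i<n. X js i * c i j)"
definition Y :: "nat list \<Rightarrow> nat \<Rightarrow> rat" where "Y js k = (\<Sum>j\<leftarrow>js. if j = k then 1 / M j else 0)"
definition D :: "nat list \<Rightarrow> rat" where "D js = (\<Sum>j\<leftarrow>js. 1 / M j)"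
definition L :: "nat list \<Rightarrow> nat \<Rightarrow> rat" where "L js i = (\<Sum>j\<leftarrow>js. c i j / M j)"

fun A :: "nat list \<Rightarrow> rat" where
  "A [] = 0"
| "A (j # js) = A js + V js j / M j"

text \<open>A round is identified by the history before it, which determines the query, and by the
  column that answered it.\<close>

fun rounds :: "nat list \<Rightarrow> (nat list \<times> nat) set" where
  "rounds [] = {}"
| "rounds (j # js) = insert (js, j) (rounds js)"

lemma M_attained: "\<exists>i<n. M j = c i j"
proof -
  have "M j \<in> (\<lambda>i. c i j) ` {..<n}"
    unfolding M_def using n_pos by (intro Max_in) (auto simp: lessThan_empty_iff)
  then show ?thesis by auto
qed

lemma M_pos: "j \<in> J \<Longrightarrow> M j > 0"
  using M_attained[of j] c_pos by metis

lemma c_le_M: "i < n \<Longrightarrow> c i j \<le> M j"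
  unfolding M_def by (intro Max_ge) auto

lemma W_Nil [simp]: "W [] i = 1"
  and W_Cons: "W (j # js) i = W js i * (1 + c i j / (M j * of_nat H))"
  by (simp_all add: W_def)

lemma Y_Nil [simp]: "Y [] k = 0"
  and Y_Cons: "Y (j # js) k = (if j = k then 1 / M j else 0) + Y js k"
  and D_Nil [simp]: "D [] = 0" and D_Cons: "D (j # js) = 1 / M j + D js"
  and L_Nil [simp]: "L [] i = 0" and L_Cons: "L (j # js) i = c i j / M j + L js i"
  by (simp_all add: Y_def D_def L_def)

lemma W_pos: "set js \<subseteq> J \<Longrightarrow> i < n \<Longrightarrow> W js i > 0"
proof (induction js)
  case (Cons j js)
  have "c i j / (M j * of_nat H) \<ge> 0"
    using Cons.prems c_pos[of i j] M_pos[of j] by simp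
  then show ?case using Cons by (simp add: W_Cons)
qed simp

lemma S_pos: "set js \<subseteq> J \<Longrightarrow> S js > 0"
  unfolding S_def using n_pos W_pos by (intro sum_pos) (auto simp: lessThan_empty_iff)

lemma X_pos: "set js \<subseteq> J \<Longrightarrow> i < n \<Longrightarrow> X js i > 0"
  unfolding X_def using W_pos S_pos by simp

lemma sum_X: "set js \<subseteq> J \<Longrightarrow> (\<Sum>i<n. X js i) = 1"
  using S_pos[of js] unfolding X_def sum_divide_distrib[symmetric] S_def[symmetric] by simp

lemma V_pos: "set js \<subseteq> J \<Longrightarrow> j \<in> J \<Longrightarrow> V js j > 0"
  unfolding V_def using n_pos X_pos c_pos by (intro sum_pos) (auto simp: lessThan_empty_iff)

section \<open>Total weight against the weight of the most loaded row\<close>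

lemma S_Cons:
  assumes "set js \<subseteq> J"
  shows "S (j # js) = S js * (1 + V js j / (M j * of_nat H))"
proof -
  have "V js j * S js = (\<Sum>i<n. W js i * c i j)"
    using S_pos[OF assms] unfolding V_def sum_distrib_right X_def by (intro sum.cong) auto
  moreover have "S (j # js) = S js + (\<Sum>i<n. W js i * c i j) / (M j * of_nat H)"
    by (simp add: S_def W_Cons algebra_simps sum.distrib sum_divide_distrib)
  ultimately show ?thesis by (simp add: algebra_simps)
qed

text \<open>The weights are proportional to \<open>X js\<close>, so a round multiplies their sum by
  1 plus the expected load increase over H; 1 + v <= exp v is iterated from the initial sum
  n.\<close>

lemma S_le:
  assumes "set js \<subseteq> J"
  shows "real_of_rat (S js) \<le> real n * exp (real_of_rat (A js) / real H)"
  using assms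
proof (induction js)
  case Nil
  then show ?case by (simp add: S_def)
next
  case (Cons j js)
  let ?v = "real_of_rat (V js j) / (real_of_rat (M j) * real H)"
  have J: "set js \<subseteq> J" "j \<in> J" using Cons.prems by auto
  have "?v \<ge> 0" using V_pos[OF J] M_pos[OF J(2)] by simp
  have "real_of_rat (S (j # js)) = real_of_rat (S js) * (1 + ?v)"
    by (simp add: S_Cons[OF J(1)] of_rat_mult of_rat_add of_rat_divide)
  also have "\<dots> \<le> (real n * exp (real_of_rat (A js) / real H)) * exp ?v"
    using Cons.IH[OF J(1)] \<open>?v \<ge> 0\<close> by (intro mult_mono exp_ge_add_one_self) simp_all
  also have "\<dots> = real n * exp (real_of_rat (A (j # js)) / real H)"
    by (simp add: mult_exp_exp of_rat_add of_rat_divide add_divide_distrib)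
  finally show ?case .
qed

lemma W_ge:
  assumes "set js \<subseteq> J" "i < n"
  shows "exp (1 / real H * (1 - 1 / real H) * real_of_rat (L js i)) \<le> real_of_rat (W js i)"
  using assms(1)
proof (induction js)
  case (Cons j js)
  let ?z = "real_of_rat (c i j) / (real_of_rat (M j) * real H)"
  have J: "set js \<subseteq> J" "j \<in> J" using Cons.prems by auto
  have c: "0 < real_of_rat (c i j)" "real_of_rat (c i j) \<le> real_of_rat (M j)"
    using c_pos[OF assms(2) J(2)] c_le_M[OF assms(2)] by (simp_all add: of_rat_less_eq)
  have m: "0 < real_of_rat (M j)" using M_pos[OF J(2)] by simp
  then have z: "0 \<le> ?z" "?z \<le> 1 / real H" using c H_ge by (simp_all add: field_simps)
  have "exp (1 / real H * (1 - 1 / real H) * (real_of_rat (c i j) / real_of_rat (M j))) \<le> 1 + ?z"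
    using one_plus_ge_exp[OF z] H_ge by (simp add: mult.commute)
  then have "exp (1 / real H * (1 - 1 / real H) * real_of_rat (L js i)) *
      exp (1 / real H * (1 - 1 / real H) * (real_of_rat (c i j) / real_of_rat (M j)))
      \<le> real_of_rat (W js i) * (1 + ?z)"
    using Cons.IH[OF J(1)] W_pos[OF J(1) assms(2)] by (intro mult_mono) simp_all
  then show ?case
    by (simp add: mult_exp_exp W_Cons L_Cons of_rat_add of_rat_mult of_rat_divide distrib_left add.commute)
qed simp

text \<open>In each round a row attaining \<open>M j\<close> gains load exactly 1 and no row loses
  any.\<close>

lemma sum_L_ge: "set js \<subseteq> J \<Longrightarrow> of_nat (length js) \<le> (\<Sum>i<n. L js i)"
proof (induction js)
  case (Cons j js)
  obtain i where i: "i < n" "M j = c i j" using M_attained by blast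
  have J: "j \<in> J" using Cons.prems by simp
  have "1 = c i j / M j" using i M_pos[OF J] by simp
  also have "\<dots> \<le> (\<Sum>i<n. c i j / M j)"
    using i c_pos[OF _ J] M_pos[OF J] by (intro member_le_sum) (auto intro: less_imp_le)
  finally show ?case using Cons by (simp add: L_Cons sum.distrib)
qed simp

lemma D_pos: "set js \<subseteq> J \<Longrightarrow> js \<noteq> [] \<Longrightarrow> D js > 0"
proof (induction js)
  case (Cons j js)
  have "D js \<ge> 0" using Cons by (cases js) auto
  then show ?case using M_pos[of j] Cons.prems by (simp add: D_Cons add_pos_nonneg)
qed simp

text \<open>Comparing the two bounds on the largest weight, \<open>ln n \<le> n\<close> is absorbed into the load of the
  corresponding row, which is at least \<open>n H\<^sup>2\<close>.\<close>

lemma load_le: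
  assumes "set js \<subseteq> J" "length js \<ge> n * n * H * H" "i < n"
  shows "(1 - 2 / real H) * real_of_rat (L js i) \<le> real_of_rat (A js)"
proof -
  let ?L = "\<lambda>i. real_of_rat (L js i)"
  have "Max (?L ` {..<n}) \<in> ?L ` {..<n}" using assms(3) by (intro Max_in) auto
  then obtain m where m: "m < n" "?L m = Max (?L ` {..<n})" by force
  have max: "?L k \<le> ?L m" if "k < n" for k using that unfolding m(2) by (intro Max_ge) auto
  have H: "real H \<ge> 2" using H_ge by simp
  have "real (n * n * H * H) \<le> real (length js)" using assms(2) by (simp only: of_nat_le_iff)
  also have "\<dots> = real_of_rat (of_nat (length js))" by simp
  also have "\<dots> \<le> real_of_rat (\<Sum>i<n. L js i)" using sum_L_ge[OF assms(1)] by (simp only: of_rat_less_eq)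
  also have "\<dots> = (\<Sum>i<n. ?L i)" by (simp add: of_rat_sum)
  also have "\<dots> \<le> (\<Sum>i<n. ?L m)" using max by (intro sum_mono) simp
  also have "\<dots> = real n * ?L m" by simp
  finally have "real n * (real n * real H * real H) \<le> real n * ?L m" by (simp add: mult.assoc)
  \<comment> \<open>The maximum is at least the mean of the n loads, whose sum is at least n^2
    H^2.\<close>
  then have big: "real n * real H * real H \<le> ?L m" using n_pos by simp
  have "exp (1 / real H * (1 - 1 / real H) * ?L m) \<le> real_of_rat (W js m)"
    by (rule W_ge[OF assms(1) m(1)])
  also have "\<dots> \<le> real_of_rat (S js)"
    unfolding S_def of_rat_less_eq
    using m(1) W_pos[OF assms(1)] by (intro member_le_sum) (auto intro: less_imp_le)
  also have "\<dots> \<le> real n * exp (real_of_rat (A js) / real H)" by (rule S_le[OF assms(1)])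
  also have "\<dots> \<le> exp (real n) * exp (real_of_rat (A js) / real H)"
    using exp_ge_add_one_self[of "real n"] by (intro mult_right_mono) (linarith, simp)
  finally have "1 / real H * (1 - 1 / real H) * ?L m \<le> real n + real_of_rat (A js) / real H"
    by (simp add: mult_exp_exp)
  then have "real H * (1 / real H * (1 - 1 / real H) * ?L m) \<le> real H * (real n + real_of_rat (A js) / real H)"
    using H by (intro mult_left_mono) simp_all
  then have "(1 - 1 / real H) * ?L m \<le> real n * real H + real_of_rat (A js)"
    using H by (simp add: distrib_left mult.commute)
  \<comment> \<open>This is where the round count enters: the additive error n H is a fraction 1 / H
    of the largest load, which turns 1 - 1 / H into 1 - 2 / H.\<close>
  moreover have "real n * real H \<le> ?L m / real H" using big H by (simp add: field_simps)
  ultimately have "(1 - 2 / real H) * ?L m \<le> real_of_rat (A js)" by (simp add: left_diff_distrib)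
  moreover have "(1 - 2 / real H) * ?L i \<le> (1 - 2 / real H) * ?L m"
    using max[OF assms(3)] H by (intro mult_left_mono) simp_all
  ultimately show ?thesis by linarith
qed

text \<open>The quotient of \<open>A js\<close> by \<open>D js\<close> is a mean of the payoffs of
  the rounds, weighted by the step sizes, so a common bound on these payoffs carries over.\<close>

lemma A_le:
  assumes "set js \<subseteq> J" "\<And>js' j. (js', j) \<in> rounds js \<Longrightarrow> real_of_rat (V js' j) \<le> v"
  shows "real_of_rat (A js) \<le> real_of_rat (D js) * v"
  using assms
proof (induction js)
  case (Cons j js)
  have "real_of_rat (V js j) / real_of_rat (M j) \<le> v / real_of_rat (M j)"
    using Cons.prems M_pos[of j] by (intro divide_right_mono) simp_all
  moreover have "real_of_rat (A js) \<le> real_of_rat (D js) * v" using Cons by simp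
  ultimately show ?case by (simp add: D_Cons of_rat_add of_rat_divide distrib_right)
qed simp

lemma rounds_set: "(js', j) \<in> rounds js \<Longrightarrow> j \<in> set js \<and> set js' \<subseteq> set js"
  by (induction js) auto

lemma Y_eq_0: "k \<notin> set js \<Longrightarrow> Y js k = 0"
  by (induction js) (auto simp: Y_Cons)

lemma Y_nonneg: "set js \<subseteq> J \<Longrightarrow> Y js k \<ge> 0"
proof (induction js)
  case (Cons j js)
  then show ?case using M_pos[of j] by (auto simp: Y_Cons intro: add_nonneg_nonneg less_imp_le)
qed simp

lemma Y_pos: "set js \<subseteq> J \<Longrightarrow> k \<in> set js \<Longrightarrow> Y js k > 0"
proof (induction js)
  case (Cons j js)
  then show ?case using M_pos[of j] Y_nonneg[of js k]
    by (auto simp: Y_Cons intro: add_pos_nonneg)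
qed simp

text \<open>Regroups rounds by column: an average over Player II's strategy becomes a sum over the
  history, which is how payoffs against that strategy become loads.\<close>

lemma sum_Y:
  assumes "finite J"
  shows "set js \<subseteq> J \<Longrightarrow> (\<Sum>k\<in>J. Y js k * f k) = (\<Sum>j\<leftarrow>js. f j / M j)"
  by (induction js) (simp_all add: Y_Cons distrib_right sum.distrib if_distrib[of "\<lambda>x. x * _"] assms cong: if_cong)

end

section \<open>Guarantees of the computed strategies\<close>

lemma expected_payoff_pure:
  "finite J \<Longrightarrow> j \<in> J \<Longrightarrow> expected_payoff I J C x (pure_strategy j) = (\<Sum>i\<in>I. x i * C i j)"
  unfolding expected_payoff_def pure_strategy_def
  by (intro sum.cong) (simp_all add: if_distrib[of "\<lambda>t. _ * t * _"] cong: if_cong)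

lemma expected_payoff_columns:
  "expected_payoff I J C x y = (\<Sum>j\<in>J. y j * (\<Sum>i\<in>I. x i * C i j))"
  unfolding expected_payoff_def
  by (subst sum.swap) (simp add: sum_distrib_left mult_ac)

lemma mixed_mem: "x \<in> mixed I \<Longrightarrow> 0 \<le> x i" "x \<in> mixed I \<Longrightarrow> sum x I = 1"
  by (auto simp: mixed_def)

lemma mixed_average_le:
  "x \<in> mixed I \<Longrightarrow> (\<And>i. i \<in> I \<Longrightarrow> f i \<le> b) \<Longrightarrow> (\<Sum>i\<in>I. x i * f i) \<le> (b::real)"
proof -
  assume *: "x \<in> mixed I" "\<And>i. i \<in> I \<Longrightarrow> f i \<le> b"
  have "(\<Sum>i\<in>I. x i * f i) \<le> (\<Sum>i\<in>I. x i * b)"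
    using * by (intro sum_mono mult_left_mono mixed_mem)
  then show ?thesis using mixed_mem(2)[OF *(1)] by (simp add: sum_distrib_right[symmetric])
qed

lemma mixed_average_ge:
  "x \<in> mixed I \<Longrightarrow> (\<And>i. i \<in> I \<Longrightarrow> b \<le> f i) \<Longrightarrow> (b::real) \<le> (\<Sum>i\<in>I. x i * f i)"
  using mixed_average_le[of x I "\<lambda>i. - f i" "- b"] by (simp add: sum_negf)

lemma pure_in_mixed: "finite S \<Longrightarrow> j \<in> S \<Longrightarrow> pure_strategy j \<in> mixed S"
  by (auto simp: mixed_def pure_strategy_def)

locale positive_game = mw +
  fixes C :: "nat \<Rightarrow> nat \<Rightarrow> real"
  assumes J: "finite J" "J \<noteq> {}"
    and C_eq: "\<And>i j. i < n \<Longrightarrow> j \<in> J \<Longrightarrow> C i j = real_of_rat (c i j)"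
begin

abbreviation payoff where "payoff \<equiv> expected_payoff {..<n} J C"
abbreviation best where "best x \<equiv> Min ((\<lambda>j. payoff x (pure_strategy j)) ` J)"

lemma best_le: 
  assumes "y \<in> mixed J"
  shows "best x \<le> payoff x y"
  unfolding expected_payoff_columns[of _ _ _ x y]
proof (rule mixed_average_ge[OF assms])
  fix j assume "j \<in> J"
  then show "best x \<le> (\<Sum>i<n. x i * C i j)"
    unfolding expected_payoff_pure[OF J(1) \<open>j \<in> J\<close>, of "{..<n}" C x, symmetric] using J(1) by (intro Min_le) auto
qed

lemma payoff_nonneg: "x \<in> mixed {..<n} \<Longrightarrow> y \<in> mixed J \<Longrightarrow> 0 \<le> payoff x y"
  unfolding expected_payoff_def
proof (intro sum_nonneg mult_nonneg_nonneg)
  fix i j assume "i \<in> {..<n}" "j \<in> J"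
  then show "0 \<le> C i j" using C_eq[of i j] c_pos[of i j] by simp
qed (auto intro: mixed_mem)

lemma mixed_J_nonempty: "mixed J \<noteq> {}" and mixed_n_nonempty: "mixed {..<n} \<noteq> {}"
  using J n_pos pure_in_mixed[of J] pure_in_mixed[of "{..<n}" 0] by auto

text \<open>Weak duality: any fixed reply of Player II bounds the inner infimum for every strategy
  of Player I. Nonnegative payoffs supply the lower bound that the infimum requires.\<close>

lemma value_le:
  assumes "y \<in> mixed J" "\<And>x. x \<in> mixed {..<n} \<Longrightarrow> payoff x y \<le> v"
  shows "game_value {..<n} J C \<le> v"
  unfolding game_value_def
proof (rule cSUP_least[OF mixed_n_nonempty])
  fix x assume x: "x \<in> mixed {..<n}"
  have "(INF y\<in>mixed J. payoff x y) \<le> payoff x y"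
    using payoff_nonneg[OF x] by (intro cINF_lower[OF _ assms(1)] bdd_belowI2) auto
  then show "(INF y\<in>mixed J. payoff x y) \<le> v" using assms(2)[OF x] by simp
qed

lemma value_ge:
  assumes "x \<in> mixed {..<n}"
  shows "best x \<le> game_value {..<n} J C"
proof -
  obtain j where j: "j \<in> J" using J by blast
  have pj: "pure_strategy j \<in> mixed J" by (rule pure_in_mixed[OF J(1) j])
  have "best x \<le> (INF y\<in>mixed J. payoff x y)"
    by (intro cINF_greatest mixed_J_nonempty best_le)
  also have "\<dots> \<le> game_value {..<n} J C"
    unfolding game_value_def
  \<comment> \<open>The supremum needs an upper bound uniform in x; the largest payoff in one fixed
    column j serves.\<close>
  proof (rule cSUP_upper[OF assms], rule bdd_aboveI2)
    fix x assume x: "x \<in> mixed {..<n}"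
    have "(INF y\<in>mixed J. payoff x y) \<le> payoff x (pure_strategy j)"
      using payoff_nonneg[OF x] by (intro cINF_lower[OF _ pj] bdd_belowI2) auto
    also have "\<dots> \<le> Max ((\<lambda>i. C i j) ` {..<n})"
      unfolding expected_payoff_pure[OF J(1) j] by (intro mixed_average_le x) auto
    finally show "(INF y\<in>mixed J. payoff x y) \<le> Max ((\<lambda>i. C i j) ` {..<n})" .
  qed
  finally show ?thesis .
qed

section \<open>Strategies obtained from a history and their guarantees\<close>

definition strat_x :: "nat list \<Rightarrow> nat \<Rightarrow> real" where
  "strat_x js i = (if i < n then real_of_rat (X js i) else 0)"

definition strat_y :: "nat list \<Rightarrow> nat \<Rightarrow> real" where
  "strat_y js k = real_of_rat (Y js k / D js)"

lemma strat_x_mixed: "set js \<subseteq> J \<Longrightarrow> strat_x js \<in> mixed {..<n}"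
  using X_pos[of js] sum_X[of js]
  by (auto simp: mixed_def strat_x_def of_rat_sum[symmetric] intro: less_imp_le)

lemma strat_y_mixed:
  assumes "set js \<subseteq> J" "js \<noteq> []"
  shows "strat_y js \<in> mixed J"
proof -
  have "(\<Sum>k\<in>J. Y js k) = D js" using sum_Y[OF J(1) assms(1), of "\<lambda>_. 1"] by (simp add: D_def)
  then have "(\<Sum>k\<in>J. Y js k / D js) = 1"
    using D_pos[OF assms] by (simp add: sum_divide_distrib[symmetric])
  moreover have "Y js k = 0" if "k \<notin> J" for k using that assms(1) by (intro Y_eq_0) auto
  ultimately show ?thesis
    using Y_nonneg[OF assms(1)] D_pos[OF assms] by (auto simp: mixed_def strat_y_def of_rat_sum[symmetric])
qed

lemma payoff_strat_x:
  "set js \<subseteq> J \<Longrightarrow> j \<in> J \<Longrightarrow> payoff (strat_x js) (pure_strategy j) = real_of_rat (V js j)"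
  by (simp add: expected_payoff_pure[OF J(1)] V_def of_rat_sum strat_x_def C_eq of_rat_mult)

lemma payoff_strat_y:
  assumes "set js \<subseteq> J"
  shows "payoff x (strat_y js) = (\<Sum>i<n. x i * (real_of_rat (L js i) / real_of_rat (D js)))"
proof -
  have *: "(\<Sum>k\<in>J. strat_y js k * C i k) = real_of_rat (L js i) / real_of_rat (D js)" if "i < n" for i
  proof -
    have "(\<Sum>k\<in>J. strat_y js k * C i k) = real_of_rat (\<Sum>k\<in>J. Y js k * c i k) / real_of_rat (D js)"
      by (simp add: strat_y_def of_rat_sum C_eq[OF that] of_rat_mult of_rat_divide sum_divide_distrib)
    then show ?thesis by (simp add: sum_Y[OF J(1) assms] L_def)
  qed
  have "payoff x (strat_y js) = (\<Sum>i<n. x i * (\<Sum>k\<in>J. strat_y js k * C i k))"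
    by (simp add: expected_payoff_def sum_distrib_left mult_ac)
  then show ?thesis using * by simp
qed

text \<open>The bound v on the rounds is left open because it is used twice: with v = \<alpha> times
  the value for Player II's guarantee, and with v = the best payoff among the rounds for Player
  I's.\<close>

lemma payoff_strat_y_le:
  assumes "set js \<subseteq> J" "length js \<ge> n * n * H * H" "H = 2 * (N + 1)" "1 / \<epsilon> \<le> real N" "\<epsilon> > 0"
    and v: "\<And>js' j. (js', j) \<in> rounds js \<Longrightarrow> real_of_rat (V js' j) \<le> v"
    and x: "x \<in> mixed {..<n}"
  shows "payoff x (strat_y js) \<le> (1 + \<epsilon>) * v"
proof -
  have "js \<noteq> []" using assms(2) n_pos H_ge by auto
  then have D: "real_of_rat (D js) > 0" using D_pos[OF assms(1)] by simp
  have N: "real N > 0" using assms(4,5) by (meson less_le_trans zero_less_divide_1_iff)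
  \<comment> \<open>Needed to enlarge the factor 1 + 1 / N to 1 + \<epsilon>.\<close>
  have "0 \<le> v"
  proof (cases js)
    case (Cons j js')
    then have "0 \<le> real_of_rat (V js' j)" using V_pos[of js' j] assms(1) by simp
    also have "\<dots> \<le> v" by (rule v) (simp add: Cons)
    finally show ?thesis .
  qed (use \<open>js \<noteq> []\<close> in simp)
  have "real_of_rat (L js i) / real_of_rat (D js) \<le> (1 + \<epsilon>) * v" if "i < n" for i
  proof -
    have "(1 - 2 / real H) * real_of_rat (L js i) \<le> real_of_rat (D js) * v"
      using load_le[OF assms(1,2) that] A_le[OF assms(1) v] by simp
    moreover have "1 - 2 / real H = real N / (real N + 1)" using assms(3) by (simp add: field_simps)
    ultimately have "real N * real_of_rat (L js i) \<le> (real N + 1) * (real_of_rat (D js) * v)"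
      by (simp add: field_simps)
    then have "real_of_rat (L js i) \<le> (1 + 1 / real N) * (real_of_rat (D js) * v)"
      using N by (simp add: field_simps)
    also have "\<dots> \<le> (1 + \<epsilon>) * (real_of_rat (D js) * v)"
    proof (intro mult_right_mono)
      show "1 + 1 / real N \<le> 1 + \<epsilon>" using assms(4,5) N by (simp add: field_simps)
    qed (use D \<open>0 \<le> v\<close> in simp)
    finally show ?thesis using D by (simp add: field_simps)
  qed
  then show ?thesis unfolding payoff_strat_y[OF assms(1)] by (intro mixed_average_le[OF x]) simp
qed

definition good :: "real \<Rightarrow> nat list \<Rightarrow> nat \<Rightarrow> bool" where
  "good \<alpha> js j \<longleftrightarrow> j \<in> J \<and> payoff (strat_x js) (pure_strategy j) \<le> \<alpha> * best (strat_x js)"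

text \<open>Every answer satisfies V <= \<alpha> \<open>best\<close> <= \<alpha> times the value,
  since the strategy queried cannot guarantee more than the value.\<close>

theorem strat_y_guarantee:
  assumes "set js \<subseteq> J" "length js \<ge> n * n * H * H" "H = 2 * (N + 1)" "1 / \<epsilon> \<le> real N" "\<epsilon> > 0" "\<alpha> \<ge> 1"
    and good: "\<And>js' j. (js', j) \<in> rounds js \<Longrightarrow> good \<alpha> js' j"
    and x: "x \<in> mixed {..<n}"
  shows "payoff x (strat_y js) \<le> \<alpha> * (1 + \<epsilon>) * game_value {..<n} J C"
proof -
  have "real_of_rat (V js' j) \<le> \<alpha> * game_value {..<n} J C" if "(js', j) \<in> rounds js" for js' j
  proof -
    have *: "set js' \<subseteq> J" "j \<in> J" using rounds_set[OF that] assms(1) by auto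
    have "real_of_rat (V js' j) \<le> \<alpha> * best (strat_x js')"
      using good[OF that] unfolding good_def payoff_strat_x[OF *] by simp
    also have "\<dots> \<le> \<alpha> * game_value {..<n} J C"
      using value_ge[OF strat_x_mixed[OF *(1)]] assms(6) by (intro mult_left_mono) simp_all
    finally show ?thesis .
  qed
  then have "payoff x (strat_y js) \<le> (1 + \<epsilon>) * (\<alpha> * game_value {..<n} J C)"
    by (rule payoff_strat_y_le[OF assms(1-5) _ x])
  then show ?thesis by (simp add: mult_ac)
qed

text \<open>Player II's strategy certifies that the value is at most 1 + \<epsilon> times the
  largest round payoff; the oracle's promise in that round bounds the payoff by \<alpha> times what
  the strategy queried there guarantees.\<close>

theorem strat_x_guarantee:
  assumes "set js \<subseteq> J" "length js \<ge> n * n * H * H" "H = 2 * (N + 1)" "1 / \<epsilon> \<le> real N" "\<epsilon> > 0" "\<alpha> \<ge> 1"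
    and good: "good \<alpha> js0 j0" and r: "(js0, j0) \<in> rounds js"
    and max: "\<And>js' j. (js', j) \<in> rounds js \<Longrightarrow> V js' j \<le> V js0 j0"
    and y: "y \<in> mixed J"
  shows "game_value {..<n} J C / (\<alpha> * (1 + \<epsilon>)) \<le> payoff (strat_x js0) y"
proof -
  have *: "set js0 \<subseteq> J" "j0 \<in> J" using rounds_set[OF r] assms(1) by auto
  have ne: "js \<noteq> []" using r by auto
  have "game_value {..<n} J C \<le> (1 + \<epsilon>) * real_of_rat (V js0 j0)"
    using max by (intro value_le[OF strat_y_mixed[OF assms(1) ne]] payoff_strat_y_le[OF assms(1-5)])
      (auto simp: of_rat_less_eq)
  also have "\<dots> \<le> (1 + \<epsilon>) * (\<alpha> * payoff (strat_x js0) y)"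
  proof (intro mult_left_mono)
    have "real_of_rat (V js0 j0) \<le> \<alpha> * best (strat_x js0)"
      using good unfolding good_def payoff_strat_x[OF *] by simp
    also have "\<dots> \<le> \<alpha> * payoff (strat_x js0) y"
      using best_le[OF y] assms(6) by (intro mult_left_mono) simp_all
    finally show "real_of_rat (V js0 j0) \<le> \<alpha> * payoff (strat_x js0) y" .
  qed (use assms(5) in simp)
  finally show ?thesis using assms(5,6) by (simp add: divide_le_eq mult_ac)
qed

end

section \<open>The program\<close>

text \<open>Variables: 2 is \<open>H\<close>, 3 the number of remaining rounds, 4 the weights and 5 their sum, 6 the
  current strategy of Player I, 7 the response to it, 10 a payoff in that column, 11
  the largest of them and 12 the expected payoff;
  13 the unnormalized strategy of Player II and 14 its sum; 15 the best payoff seen so far and 16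
  the strategy of Player I attaining it. List traversals use 8 and 9, results of loops are
  accumulated in 17 and 18.\<close>

definition normalize_prog :: "nat \<Rightarrow> nat \<Rightarrow> com" where
  "normalize_prog a d = Seq (Assign 17 (Const (Num 0))) (foreach (Var a)
     (Assign 17 (MkPair (MkPair (Fst (Var 9)) (Divide (Snd (Var 9)) (Var d))) (Var 17))))"

definition payoff_call :: com where
  "payoff_call = Call 10 PayoffEval (MkPair (Fst (Var 9)) (Var 7))"

definition scan_prog :: com where
  "scan_prog = Seq (Assign 11 (Const (Num 0))) (Seq (Assign 12 (Const (Num 0)))
     (foreach (Var 6) (Seq payoff_call
       (Seq (If (Less (Var 11) (Var 10)) (Assign 11 (Var 10)) Skip)
         (Assign 12 (Plus (Var 12) (Times (Snd (Var 9)) (Var 10))))))))"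

text \<open>A second pass over the column: the step size in the new weights needs the column
  maximum, known only after the scan.\<close>

definition update_prog :: com where
  "update_prog = Seq (Assign 17 (Const (Num 0))) (Seq (Assign 5 (Const (Num 0))) (Seq
     (foreach (Var 4) (Seq payoff_call
       (Seq (Assign 10 (Times (Snd (Var 9))
              (Plus (Const (Num 1)) (Divide (Var 10) (Times (Var 11) (Var 2))))))
       (Seq (Assign 17 (MkPair (MkPair (Fst (Var 9)) (Var 10)) (Var 17)))
         (Assign 5 (Plus (Var 5) (Var 10)))))))
     (Assign 4 (Var 17))))"

text \<open>A sparse vector lists every index once, so an earlier occurrence of the new column has to be
  merged with it.\<close>

definition merge_prog :: com where
  "merge_prog = Seq (Assign 18 (Divide (Const (Num 1)) (Var 11)))
     (Seq (Assign 14 (Plus (Var 18) (Var 14))) (Seq (Assign 17 (Const (Num 0))) (Seq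
     (foreach (Var 13)
       (If (Plus (Less (Fst (Var 9)) (Var 7)) (Less (Var 7) (Fst (Var 9))))
         (Assign 17 (MkPair (Var 9) (Var 17)))
         (Assign 18 (Plus (Var 18) (Snd (Var 9))))))
     (Assign 13 (MkPair (MkPair (Var 7) (Var 18)) (Var 17))))))"

text \<open>Variable 15 starts at 0 and expected payoffs are positive, so the first round is always
  recorded.\<close>

definition record_prog :: com where
  "record_prog = If (Less (Var 15) (Var 12)) (Seq (Assign 15 (Var 12)) (Assign 16 (Var 6))) Skip"

definition round_prog :: com where
  "round_prog = Seq (Assign 3 (Minus (Var 3) (Const (Num 1))))
     (Seq (normalize_prog 4 5) (Seq (Assign 6 (Var 17)) (Seq (Call 7 BestResponse (Var 6))
     (Seq scan_prog (Seq update_prog (Seq merge_prog record_prog))))))"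

text \<open>Counting down while consing yields the rows in increasing order; variable 12 only serves
  as a counter here.\<close>

definition weights_prog :: com where
  "weights_prog = While (Less (Const (Num 0)) (Var 12))
     (Seq (Assign 12 (Minus (Var 12) (Const (Num 1))))
       (Assign 4 (MkPair (MkPair (Var 12) (Const (Num 1))) (Var 4))))"

definition init_prog :: com where
  "init_prog = Seq (Assign 2 (Times (Const (Num 2)) (Plus (Snd (Var 0)) (Const (Num 1)))))
     (Seq (Assign 3 (Times (Fst (Var 0)) (Times (Fst (Var 0)) (Times (Var 2) (Var 2)))))
     (Seq (Assign 5 (Fst (Var 0))) (Seq (Assign 12 (Fst (Var 0))) weights_prog)))"

text \<open>One run serves both players: it leaves Player II's strategy in 17 and Player I's in 16,
  and the two algorithms differ in the variable copied to 0.\<close>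

definition solver_prog :: com where
  "solver_prog = Seq init_prog (Seq (While (Less (Const (Num 0)) (Var 3)) round_prog)
     (normalize_prog 13 14))"

section \<open>Sizes of encoded vectors, and normalization\<close>

declare val_size.simps(1) [simp del] val_size_01 [simp]

lemma val_size_enc:
  "val_size (enc f is) = 2 + (\<Sum>i\<leftarrow>is. 2 + (val_size (Num (of_nat i)) + val_size (Num (f i))))"
  by (induction "is") simp_all

lemma val_size_enc_le:
  assumes "\<And>i. i \<in> set is \<Longrightarrow> val_size (Num (of_nat i)) \<le> u" "\<And>i. i \<in> set is \<Longrightarrow> val_size (Num (f i)) \<le> v"
    and "length is \<le> m"
  shows "val_size (enc f is) \<le> 2 + m * (2 + (u + v))"
proof -
  have "val_size (enc f is) \<le> 2 + (\<Sum>i\<leftarrow>is. 2 + (u + v))"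
    unfolding val_size_enc by (intro add_left_mono sum_list_mono add_mono assms le_refl)
  also have "\<dots> = 2 + length is * (2 + (u + v))" by (simp add: sum_list_triv)
  also have "\<dots> \<le> 2 + m * (2 + (u + v))"
    by (intro add_left_mono mult_right_mono assms(3)) simp
  finally show ?thesis .
qed

text \<open>Both parts contain the terminator \<open>Num 0\<close> of size 2, the whole list only
  one.\<close>

lemma val_size_enc_append: "val_size (enc f (xs @ ys)) + 2 = val_size (enc f xs) + val_size (enc f ys)"
  by (simp add: val_size_enc)

lemma val_size_enc_rev: "val_size (enc f (rev is)) = val_size (enc f is)"
  by (simp add: val_size_enc rev_map[symmetric])

lemma val_size_enc_ge: "2 \<le> val_size (enc f is)"
  by (simp add: val_size_enc)

definition same_except :: "nat set \<Rightarrow> store \<Rightarrow> store \<Rightarrow> bool" where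
  "same_except Z s t \<longleftrightarrow> (\<forall>x. x \<notin> Z \<longrightarrow> t x = s x)"

lemma (in machine) wp_normalize:
  assumes s: "sized B s" "s a = enc f is" "s d = Num q" "a \<notin> {8, 9, 17}" "d \<notin> {8, 9, 17}"
    and size: "val_size (enc (\<lambda>i. f i / q) is) \<le> B"
  shows "wp (normalize_prog a d) s (3 + length is * 4)
    (\<lambda>t. same_except {8, 9, 17} s t \<and> t 17 = enc (\<lambda>i. f i / q) (rev is) \<and> sized B t)"
proof -
  let ?g = "\<lambda>i. f i / q"
  let ?c = "Assign 17 (MkPair (MkPair (Fst (Var 9)) (Divide (Snd (Var 9)) (Var d))) (Var 17))"
  let ?Inv = "\<lambda>pre t. same_except {8, 9, 17} s t \<and> t 17 = enc ?g (rev pre)"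
  have s0: "sized B (s(17 := Num 0))"
    using B_ge by (intro sized_upd s(1)) simp
  have "wp (foreach (Var a) ?c) (s(17 := Num 0)) (2 + length is * (1 + 3)) (\<lambda>t. ?Inv is t \<and> sized B t)"
  proof (rule wp_foreach[where f = f])
    show "val_size (enc f is) \<le> B" using s(1,2) unfolding sized_def by metis
    show "sized B (s(17 := Num 0))" by (rule s0)
  next
    fix pre i rest t
    assume split: "is = pre @ i # rest" and Inv: "?Inv pre t" and t: "sized B t"
      and t9: "t 9 = Pair (Num (of_nat i)) (Num (f i))"
    have td: "t d = Num q" using Inv s(3,5) by (simp add: same_except_def)
    \<comment> \<open>Each accumulator holds a prefix of the result in reverse, so the size bound on
      the complete result covers all of them.\<close>
    have "val_size (enc ?g (rev (pre @ [i]))) \<le> val_size (enc ?g is)"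
      using val_size_enc_append[of ?g "pre @ [i]" rest] val_size_enc_ge[of ?g rest]
      unfolding val_size_enc_rev split by simp
    then have "sized B (t(17 := enc ?g (rev (pre @ [i]))))"
      using size t by (intro sized_upd) simp_all
    then show "wp ?c t 1 (\<lambda>t'. ?Inv (pre @ [i]) t' \<and> t' 8 = t 8 \<and> sized B t')"
      using t Inv t9 td by (intro wp_Assign) (simp_all add: cost_factor_def same_except_def)
  qed (use s in \<open>simp_all add: cost_factor_def same_except_def\<close>)
  then have "wp (normalize_prog a d) s (1 + (2 + length is * (1 + 3))) (\<lambda>t. ?Inv is t \<and> sized B t)"
    unfolding normalize_prog_def
    by (intro wp_Seq wp_Assign s(1)) (simp_all add: cost_factor_def)
  then show ?thesis by (rule wp_conseq) simp_all
qed

text \<open>\<open>a\<close> bounds the bit length of payoffs, \<open>b\<close> that of all rationals occurring in the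
  computation.\<close>

locale mw_sizes = mw +
  fixes N T a b :: nat
  assumes H_def: "H = 2 * (N + 1)"
    and T_def: "T = n * n * H * H"
    and c_bits: "\<And>i j. i < n \<Longrightarrow> j \<in> J \<Longrightarrow> bits (c i j) \<le> a"
    and b_ge: "b \<ge> n * (T * (2 * a + H + 3) + 1 + (n * (T * (2 * a + H + 3) + 2) + 1) + a + 1) + 1"
      "b \<ge> 2 * (T * (a + 2) + 1)" "b \<ge> T + 1" "b \<ge> n + 1" "b \<ge> H + 1"
begin

declare W_Nil [simp del]

section \<open>Lengths of the rationals in the computation\<close>

lemma T_pos: "T \<ge> 1"
  using n_pos H_ge unfolding T_def by simp

lemma num_nat_le: "k + 1 \<le> b \<Longrightarrow> val_size (Num (of_nat k)) \<le> 2 * b + 1"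
  using val_size_Num_le[of "of_nat k"] bits_of_nat[of k] by linarith

lemma M_bits: "j \<in> J \<Longrightarrow> bits (M j) \<le> a"
  using M_attained[of j] c_bits by metis

text \<open>Each round multiplies a weight by a factor of at most 2 a + H + 3 bits, so even exact
  weights grow only linearly with the number of rounds.\<close>

lemma W_bits:
  assumes "i < n"
  shows "set js \<subseteq> J \<Longrightarrow> bits (W js i) \<le> length js * (2 * a + H + 3) + 1"
proof (induction js)
  case (Cons j js)
  have J: "j \<in> J" using Cons.prems by simp
  have "bits (M j * of_nat H) \<le> a + (H + 1)"
    using bits_mult[of "M j" "of_nat H"] M_bits[OF J] bits_of_nat[of H] by linarith
  then have "bits (c i j / (M j * of_nat H)) \<le> a + (a + (H + 1))"
    using bits_divide[of "c i j" "M j * of_nat H"] c_bits[OF assms J] by linarith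
  then have "bits (1 + c i j / (M j * of_nat H)) \<le> 2 * a + H + 3"
    using bits_add_diff(1)[of 1 "c i j / (M j * of_nat H)"] by simp
  then have "bits (W js i * (1 + c i j / (M j * of_nat H))) \<le> length js * (2 * a + H + 3) + 1 + (2 * a + H + 3)"
    using bits_mult[of "W js i" "1 + c i j / (M j * of_nat H)"] Cons by simp
  then show ?case by (simp add: W_Cons)
qed (simp add: W_Nil)

definition weight_bits :: nat where "weight_bits = T * (2 * a + H + 3) + 1"
definition total_bits :: nat where "total_bits = n * (weight_bits + 1) + 1"

lemma b_ge_total: "b \<ge> n * (weight_bits + total_bits + a + 1) + 1"
  using b_ge(1) by (simp add: weight_bits_def total_bits_def add.assoc)

lemma b_ge_X: "b \<ge> weight_bits + total_bits + a"
proof -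
  have "weight_bits + total_bits + a \<le> 1 * (weight_bits + total_bits + a + 1)" by simp
  also have "\<dots> \<le> n * (weight_bits + total_bits + a + 1)" using n_pos by (intro mult_right_mono) simp_all
  also have "\<dots> \<le> b" by (rule le_trans[OF le_add1 b_ge_total])
  finally show ?thesis .
qed

context
  fixes js assumes js: "set js \<subseteq> J" "length js \<le> T"
begin

lemma W_weight_bits: "i < n \<Longrightarrow> bits (W js i) \<le> weight_bits"
proof -
  assume "i < n"
  then have "bits (W js i) \<le> length js * (2 * a + H + 3) + 1" by (rule W_bits) (rule js(1))
  also have "\<dots> \<le> weight_bits" unfolding weight_bits_def using js(2) by (intro add_right_mono mult_right_mono) simp_all
  finally show ?thesis .
qed

lemma W_bits_le: "i < n \<Longrightarrow> bits (W js i) \<le> b"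
  using W_weight_bits b_ge_X by fastforce

lemma partial_sum_bits:
  assumes "set is \<subseteq> {..<n}" "length is \<le> n"
  shows "bits (\<Sum>i\<leftarrow>is. W js i) \<le> total_bits"
proof -
  have "bits (\<Sum>i\<leftarrow>is. W js i) \<le> length is * (weight_bits + 1) + 1"
    using assms W_weight_bits by (intro bits_sum_list) auto
  also have "\<dots> \<le> total_bits" unfolding total_bits_def using assms(2) by (intro add_right_mono mult_right_mono) simp_all
  finally show ?thesis .
qed

lemma S_eq: "distinct is \<Longrightarrow> set is = {..<n} \<Longrightarrow> (\<Sum>i\<leftarrow>is. W js i) = S js"
  by (simp add: S_def sum_list_distinct_conv_sum_set)

lemma S_bits: "bits (S js) \<le> total_bits"
  using partial_sum_bits[of "[0..<n]"] S_eq[of "[0..<n]"] by (simp add: atLeast_upt)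

lemma X_weight_bits: "i < n \<Longrightarrow> bits (X js i) \<le> weight_bits + total_bits"
  using bits_divide[of "W js i" "S js"] S_bits W_weight_bits[of i] unfolding X_def by linarith

lemma X_bits_le: "i < n \<Longrightarrow> bits (X js i) \<le> b"
  using X_weight_bits b_ge_X by fastforce

lemma partial_payoff_bits:
  assumes "set is \<subseteq> {..<n}" "length is \<le> n" "j \<in> J"
  shows "bits (\<Sum>i\<leftarrow>is. X js i * c i j) \<le> b"
proof -
  have "bits (\<Sum>i\<leftarrow>is. X js i * c i j) \<le> length is * (weight_bits + total_bits + a + 1) + 1"
  proof (intro bits_sum_list)
    fix i assume "i \<in> set is"
    then have "i < n" using assms(1) by auto
    then show "bits (X js i * c i j) \<le> weight_bits + total_bits + a"
      using bits_mult[of "X js i" "c i j"] X_weight_bits[of i] c_bits[OF _ assms(3), of i] by linarith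
  qed
  also have "\<dots> \<le> n * (weight_bits + total_bits + a + 1) + 1"
    using assms(2) by (intro add_right_mono mult_right_mono) simp_all
  finally show ?thesis using b_ge_total by linarith
qed

lemma step_sum_bits:
  assumes "\<And>j. j \<in> J \<Longrightarrow> bits (f j) \<le> a + 1"
  shows "bits (\<Sum>j\<leftarrow>js. f j) \<le> T * (a + 2) + 1"
proof -
  have "bits (\<Sum>j\<leftarrow>js. f j) \<le> length js * (a + 1 + 1) + 1"
    using assms js(1) by (intro bits_sum_list) auto
  also have "\<dots> \<le> T * (a + 2) + 1" using js(2) by (intro add_right_mono mult_mono) simp_all
  finally show ?thesis .
qed

lemma step_bits: "j \<in> J \<Longrightarrow> bits (1 / M j) \<le> a + 1"
  using bits_divide[of 1 "M j"] M_bits[of j] by simp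

lemma Y_bits: "bits (Y js k) \<le> T * (a + 2) + 1"
  unfolding Y_def by (intro step_sum_bits) (use step_bits in auto)

lemma D_bits: "bits (D js) \<le> T * (a + 2) + 1"
  unfolding D_def by (intro step_sum_bits step_bits)

end

lemma a_le_b: "a + 1 \<le> b"
  using b_ge_X unfolding weight_bits_def by linarith

lemma b_ge_Y: "T * (a + 2) + 1 \<le> b"
  by (rule le_trans[OF _ b_ge(2)]) simp

text \<open>Bounds the query to the best response procedure. The bound involves only n and b, so the
  cost R of calls can be chosen after it.\<close>

lemma val_size_X:
  assumes "set js \<subseteq> J" "length js \<le> T" "distinct is" "set is = {..<n}"
  shows "val_size (enc (X js) is) \<le> 2 + n * (2 + ((2 * b + 1) + (2 * b + 1)))"
proof (rule val_size_enc_le)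
  fix i assume "i \<in> set is"
  then have "i < n" using assms(4) by simp
  then show "val_size (Num (of_nat i)) \<le> 2 * b + 1" using b_ge(4) by (intro num_nat_le) simp
  show "val_size (Num (X js i)) \<le> 2 * b + 1"
    using val_size_Num_le[of "X js i"] X_bits_le[OF assms(1,2) \<open>i < n\<close>] by linarith
next
  show "length is \<le> n" using distinct_card[OF assms(3)] assms(4) by simp
qed

end

text \<open>G stands for the promise attached to an oracle answer, which the analysis of the program
  merely carries along. R bounds both the cost of a call and the size of the column name it returns;
  in B, the T + n entries allow for lists of rows as well as of played columns.\<close>

locale solver = mw_sizes n H J c N T a b + machine \<Gamma> B R
  for n H J c \<Gamma> B R N T a b +
  fixes G :: "nat list \<Rightarrow> nat \<Rightarrow> bool"
  assumes B_bound: "B \<ge> 2 + (T + n) * (2 + (R + (2 * b + 1) + (2 * b + 1)))"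
    and best_response: "\<And>js is. set js \<subseteq> J \<Longrightarrow> length js < T \<Longrightarrow> distinct is \<Longrightarrow> set is = {..<n} \<Longrightarrow>
        \<exists>k j. computes \<Gamma> (\<Gamma> BestResponse) (enc (X js) is) k (Num (of_nat j)) \<and> k \<le> R \<and>
          val_size (Num (of_nat j)) \<le> R \<and> j \<in> J \<and> G js j"
    and payoff_eval: "\<And>i j. i < n \<Longrightarrow> j \<in> J \<Longrightarrow>
        \<exists>k. computes \<Gamma> (\<Gamma> PayoffEval) (Pair (Num (of_nat i)) (Num (of_nat j))) k (Num (c i j)) \<and> k \<le> R"
begin

declare W_Nil [simp del]

lemma num_le_B: "bits q \<le> b \<Longrightarrow> val_size (Num q) \<le> B"
proof -
  assume "bits q \<le> b"
  then have "val_size (Num q) \<le> 2 * b + 1" using val_size_Num_le[of q] by linarith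
  also have "\<dots> \<le> 2 + 1 * (2 + (R + (2 * b + 1) + (2 * b + 1)))" by simp
  also have "\<dots> \<le> 2 + (T + n) * (2 + (R + (2 * b + 1) + (2 * b + 1)))"
    using n_pos by (intro add_left_mono mult_right_mono) simp_all
  finally show ?thesis using B_bound by linarith
qed

lemma R_le_B: "R \<le> B"
proof -
  have "R \<le> 2 + 1 * (2 + (R + (2 * b + 1) + (2 * b + 1)))" by simp
  also have "\<dots> \<le> 2 + (T + n) * (2 + (R + (2 * b + 1) + (2 * b + 1)))"
    using n_pos by (intro add_left_mono mult_right_mono) simp_all
  finally show ?thesis using B_bound by linarith
qed

lemma enc_le_B:
  assumes "\<And>i. i \<in> set is \<Longrightarrow> val_size (Num (of_nat i)) \<le> R + (2 * b + 1)"
    "\<And>i. i \<in> set is \<Longrightarrow> bits (f i) \<le> b" "length is \<le> T + n"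
  shows "val_size (enc f is) \<le> B"
proof -
  have v: "val_size (Num (f i)) \<le> 2 * b + 1" if "i \<in> set is" for i
    using assms(2)[OF that] val_size_Num_le[of "f i"] by linarith
  have "val_size (enc f is) \<le> 2 + (T + n) * (2 + (R + (2 * b + 1) + (2 * b + 1)))"
    by (rule val_size_enc_le[OF assms(1) v assms(3)])
  then show ?thesis using B_bound by (rule le_trans)
qed

lemma enc_rows_le_B:
  assumes "set is \<subseteq> {..<n}" "distinct is" "\<And>i. i < n \<Longrightarrow> bits (f i) \<le> b"
  shows "val_size (enc f is) \<le> B"
proof (rule enc_le_B)
  fix i assume "i \<in> set is"
  then have "i + 1 \<le> b" using assms(1) b_ge(4) by auto
  then show "val_size (Num (of_nat i)) \<le> R + (2 * b + 1)" using num_nat_le by (meson le_trans le_add2)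
next
  have "length is = card (set is)" using assms(2) by (simp add: distinct_card)
  also have "\<dots> \<le> n" using card_mono[OF _ assms(1)] by simp
  finally show "length is \<le> T + n" by simp
qed (use assms in auto)

section \<open>Verification of the subprograms\<close>

lemma wp_payoff_call:
  assumes "sized B t" "t 9 = Pair (Num (of_nat i)) v" "t 7 = Num (of_nat j)" "i < n" "j \<in> J"
    and "sized B (t(10 := Num (c i j))) \<Longrightarrow> P (t(10 := Num (c i j)))"
  shows "wp payoff_call t 1 P"
proof -
  obtain k where k: "computes \<Gamma> (\<Gamma> PayoffEval) (Pair (Num (of_nat i)) (Num (of_nat j))) k (Num (c i j))"
    "k \<le> R" using payoff_eval[OF assms(4,5)] by blast
  have v: "val_size (Num (c i j)) \<le> B" using c_bits[OF assms(4,5)] a_le_b by (intro num_le_B) simp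
  have "eval (MkPair (Fst (Var 9)) (Var 7)) t = Pair (Num (of_nat i)) (Num (of_nat j))"
    using assms(2,3) by simp
  with k v show ?thesis unfolding payoff_call_def
    by (intro wp_Call[OF assms(1), where k = k and v = "Num (c i j)"] assms(6) sized_upd[OF assms(1)])
      (simp_all add: cost_factor_def)
qed

lemma wp_scan:
  assumes s: "sized B s" "s 6 = enc (X js) is" "s 7 = Num (of_nat j)"
    and js: "set js \<subseteq> J" "length js \<le> T" and j: "j \<in> J" and "is": "distinct is" "set is = {..<n}"
  shows "wp scan_prog s (4 + length is * 7)
    (\<lambda>t. same_except {8, 9, 10, 11, 12} s t \<and> t 11 = Num (M j) \<and> t 12 = Num (V js j) \<and> sized B t)"
proof -
  \<comment> \<open>The inserted 0 is the initial value of variable 11; it disappears at the end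
    because the column maximum is positive.\<close>
  define m where "m pre = Max (insert 0 ((\<lambda>i. c i j) ` set pre))" for pre
  let ?v = "\<lambda>pre. \<Sum>i\<leftarrow>pre. X js i * c i j"
  let ?Inv = "\<lambda>pre t. same_except {8, 9, 10, 11, 12} s t \<and> t 11 = Num (m pre) \<and> t 12 = Num (?v pre)"
  let ?if = "If (Less (Var 11) (Var 10)) (Assign 11 (Var 10)) Skip"
  let ?add = "Assign 12 (Plus (Var 12) (Times (Snd (Var 9)) (Var 10)))"
  let ?c = "Seq payoff_call (Seq ?if ?add)"
  let ?s = "s(11 := Num 0, 12 := Num 0)"
  have zero: "val_size (Num 0) \<le> B" using B_ge by simp
  have len: "length is = n" using "is" distinct_card[of "is"] by simp
  have "wp (foreach (Var 6) ?c) ?s (2 + length is * (4 + 3)) (\<lambda>t. ?Inv is t \<and> sized B t)"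
  proof (rule wp_foreach[where f = "X js"])
    show "val_size (enc (X js) is) \<le> B" using s(1,2) unfolding sized_def by metis
    show "sized B ?s" by (intro sized_upd zero s(1))
  next
    fix pre i rest t
    assume split: "is = pre @ i # rest" and Inv: "?Inv pre t" and t: "sized B t"
      and t9: "t 9 = Pair (Num (of_nat i)) (Num (X js i))"
    have i: "i < n" using split "is"(2) by (metis in_set_conv_decomp lessThan_iff)
    have t7: "t 7 = Num (of_nat j)" using Inv s(3) by (simp add: same_except_def)
    have "insert 0 ((\<lambda>i. c i j) ` set (pre @ [i])) = insert (c i j) (insert 0 ((\<lambda>i. c i j) ` set pre))"
      by auto
    then have m: "m (pre @ [i]) = max (c i j) (m pre)" unfolding m_def by simp
    have sub: "set (pre @ [i]) \<subseteq> {..<n}" "length (pre @ [i]) \<le> n"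
      using split "is"(2) len by auto
    have "m (pre @ [i]) \<in> insert 0 ((\<lambda>i. c i j) ` set (pre @ [i]))"
      unfolding m_def by (rule Max_in) simp_all
    then have "bits (m (pre @ [i])) \<le> b"
    proof
      assume "m (pre @ [i]) = 0"
      then show ?thesis using a_le_b by simp
    next
      assume "m (pre @ [i]) \<in> (\<lambda>i. c i j) ` set (pre @ [i])"
      then obtain k where "k \<in> set (pre @ [i])" "m (pre @ [i]) = c k j" by blast
      then show ?thesis using c_bits[OF _ j, of k] sub(1) a_le_b by fastforce
    qed
    then have mB: "val_size (Num (m (pre @ [i]))) \<le> B" by (rule num_le_B)
    have vB: "val_size (Num (?v (pre @ [i]))) \<le> B"
      using partial_payoff_bits[OF js sub j] by (rule num_le_B)
    let ?P = "\<lambda>t'. ?Inv (pre @ [i]) t' \<and> t' 8 = t 8 \<and> sized B t'"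
    show "wp ?c t 4 ?P"
    proof -
      let ?t1 = "t(10 := Num (c i j))" and ?t2 = "t(10 := Num (c i j), 11 := Num (m (pre @ [i])))"
      have body: "wp (Seq ?if ?add) ?t1 (1 + 1 + 1) ?P" if t1: "sized B ?t1"
      proof -
        have t2: "sized B ?t2" by (intro sized_upd t1 mB)
        have 3: "wp ?add ?t2 1 ?P"
        proof (rule wp_Assign[OF t2])
          have "sized B (?t2(12 := Num (?v (pre @ [i]))))" by (intro sized_upd t2 vB)
          then show "?P (?t2(12 := eval (Plus (Var 12) (Times (Snd (Var 9)) (Var 10))) ?t2))"
            using Inv t9 by (simp add: same_except_def)
        qed (simp add: cost_factor_def)
        have "wp ?if ?t1 (1 + 1) (\<lambda>t. wp ?add t 1 ?P)"
        proof (rule wp_If[OF t1])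
          assume "eval (Less (Var 11) (Var 10)) ?t1 \<noteq> Num 0"
          then have "m pre < c i j" using Inv by (simp split: if_splits)
          then have "?t1(11 := eval (Var 10) ?t1) = ?t2" unfolding m by simp
          then show "wp (Assign 11 (Var 10)) ?t1 1 (\<lambda>t. wp ?add t 1 ?P)"
            using 3 by (intro wp_Assign[OF t1]) (simp_all add: cost_factor_def)
        next
          \<comment> \<open>Variable 11 already holds the new maximum, so this branch also reaches
            \<open>?t2\<close> and \<open>3\<close> applies to both.\<close>
          assume "eval (Less (Var 11) (Var 10)) ?t1 = Num 0"
          then have "\<not> m pre < c i j" using Inv by (simp split: if_splits)
          then have "Num (m (pre @ [i])) = ?t1 11" unfolding m using Inv by simp
          then have "?t1 = ?t2" by (metis fun_upd_triv)
          then show "wp Skip ?t1 1 (\<lambda>t. wp ?add t 1 ?P)" using 3 by (intro wp_Skip) simp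
        qed (simp add: cost_factor_def)
        then show ?thesis by (rule wp_Seq)
      qed
      have "wp ?c t (1 + (1 + 1 + 1)) ?P"
        by (rule wp_Seq, rule wp_payoff_call[OF t t9 t7 i j], rule body)
      then show ?thesis by (rule wp_conseq) simp_all
    qed
  qed (use s in \<open>simp_all add: cost_factor_def same_except_def m_def\<close>)
  then have "wp scan_prog s (1 + (1 + (2 + length is * (4 + 3)))) (\<lambda>t. ?Inv is t \<and> sized B t)"
    unfolding scan_prog_def
    by (intro wp_Seq wp_Assign s(1) sized_upd) (use zero in \<open>simp_all add: cost_factor_def\<close>)
  moreover have "m is = M j"
  proof -
    have "Max (insert 0 ((\<lambda>i. c i j) ` {..<n})) = max 0 (M j)"
      unfolding M_def using n_pos by (intro Max_insert) (auto simp: lessThan_empty_iff)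
    then show ?thesis using M_pos[OF j] "is"(2) unfolding m_def by simp
  qed
  moreover have "?v is = V js j"
    unfolding V_def using "is" by (simp add: sum_list_distinct_conv_sum_set)
  ultimately show ?thesis by (elim wp_conseq) simp_all
qed

lemma wp_update:
  assumes s: "sized B s" "s 4 = enc (W js) is" "s 7 = Num (of_nat j)" "s 11 = Num (M j)"
      "s 2 = Num (of_nat H)"
    and js: "set js \<subseteq> J" "length js < T" and j: "j \<in> J" and "is": "distinct is" "set is = {..<n}"
  shows "wp update_prog s (5 + length is * 7)
    (\<lambda>t. same_except {4, 5, 8, 9, 10, 17} s t \<and> t 4 = enc (W (j # js)) (rev is) \<and>
      t 5 = Num (S (j # js)) \<and> sized B t)"
proof -
  let ?w = "W (j # js)"
  have js': "set (j # js) \<subseteq> J" "length (j # js) \<le> T" using js j by simp_all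
  let ?Inv = "\<lambda>pre t. same_except {4, 5, 8, 9, 10, 17} s t \<and> t 17 = enc ?w (rev pre) \<and> t 5 = Num (\<Sum>i\<leftarrow>pre. ?w i)"
  let ?mul = "Assign 10 (Times (Snd (Var 9)) (Plus (Const (Num 1)) (Divide (Var 10) (Times (Var 11) (Var 2)))))"
  let ?cons = "Assign 17 (MkPair (MkPair (Fst (Var 9)) (Var 10)) (Var 17))"
  let ?add = "Assign 5 (Plus (Var 5) (Var 10))"
  let ?c = "Seq payoff_call (Seq ?mul (Seq ?cons ?add))"
  let ?s = "s(17 := Num 0, 5 := Num 0)"
  have zero: "val_size (Num 0) \<le> B" using B_ge by simp
  have len: "length is = n" using "is" distinct_card[of "is"] by simp
  have loop: "wp (foreach (Var 4) ?c) ?s (2 + length is * (4 + 3)) (\<lambda>t. ?Inv is t \<and> sized B t)"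
  proof (rule wp_foreach[where f = "W js"])
    show "val_size (enc (W js) is) \<le> B" using s(1,2) unfolding sized_def by metis
    show "sized B ?s" by (intro sized_upd zero s(1))
  next
    fix pre i rest t
    assume split: "is = pre @ i # rest" and Inv: "?Inv pre t" and t: "sized B t"
      and t9: "t 9 = Pair (Num (of_nat i)) (Num (W js i))"
    have i: "i < n" using split "is"(2) by (metis in_set_conv_decomp lessThan_iff)
    have tt: "t 7 = Num (of_nat j)" "t 11 = Num (M j)" "t 2 = Num (of_nat H)"
      using Inv s(3-5) by (simp_all add: same_except_def)
    have sub: "set (pre @ [i]) \<subseteq> {..<n}" "length (pre @ [i]) \<le> n" "distinct (rev (pre @ [i]))"
      using split "is" len by auto
    have B: "val_size (Num (?w i)) \<le> B" "val_size (enc ?w (rev (pre @ [i]))) \<le> B"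
      "val_size (Num (\<Sum>i\<leftarrow>pre @ [i]. ?w i)) \<le> B"
      using W_bits_le[OF js'] i sub partial_sum_bits[OF js' sub(1,2)] b_ge_X
      by (auto intro!: num_le_B enc_rows_le_B simp del: rev_append)
    let ?P = "\<lambda>t'. ?Inv (pre @ [i]) t' \<and> t' 8 = t 8 \<and> sized B t'"
    let ?t1 = "t(10 := Num (c i j))"
    \<comment> \<open>Variable 10 is reused: first the payoff, then the new weight computed from
      it.\<close>
    let ?t2 = "?t1(10 := Num (?w i))"
    let ?t3 = "?t2(17 := enc ?w (rev (pre @ [i])))"
    let ?t4 = "?t3(5 := Num (\<Sum>i\<leftarrow>pre @ [i]. ?w i))"
    have body: "wp (Seq ?mul (Seq ?cons ?add)) ?t1 (1 + (1 + 1)) ?P" if t1: "sized B ?t1"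
    proof -
      have t2: "sized B ?t2" by (intro sized_upd t1 B)
      have t3: "sized B ?t3" by (intro sized_upd t2 B)
      have t4: "sized B ?t4" by (intro sized_upd t3 B)
      have "?P ?t4" using t4 Inv by (simp add: same_except_def)
      moreover have "?t3(5 := eval (Plus (Var 5) (Var 10)) ?t3) = ?t4" using Inv by simp
      ultimately have 4: "wp ?add ?t3 1 ?P"
        by (intro wp_Assign[OF t3]) (simp_all only: cost_factor_def, simp)
      have "?t2(17 := eval (MkPair (MkPair (Fst (Var 9)) (Var 10)) (Var 17)) ?t2) = ?t3" using Inv t9 by simp
      then have 3: "wp ?cons ?t2 1 (\<lambda>t. wp ?add t 1 ?P)"
        using 4 by (intro wp_Assign[OF t2]) (simp_all only: cost_factor_def, simp)
      have "?t1(10 := eval (Times (Snd (Var 9)) (Plus (Const (Num 1)) (Divide (Var 10) (Times (Var 11) (Var 2))))) ?t1) = ?t2"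
        using t9 tt by (simp add: W_Cons)
      then have "wp ?mul ?t1 1 (\<lambda>t. wp (Seq ?cons ?add) t (1 + 1) ?P)"
        using wp_Seq[OF 3] by (intro wp_Assign[OF t1]) (simp_all only: cost_factor_def, simp)
      then show ?thesis by (rule wp_Seq)
    qed
    have "wp ?c t (1 + (1 + (1 + 1))) ?P"
      by (rule wp_Seq, rule wp_payoff_call[OF t t9 tt(1) i j], rule body)
    then show "wp ?c t 4 ?P" by (rule wp_conseq) simp_all
  qed (use s in \<open>simp_all add: cost_factor_def same_except_def\<close>)
  have last: "wp (Assign 4 (Var 17)) t 1 (\<lambda>t. same_except {4, 5, 8, 9, 10, 17} s t \<and>
      t 4 = enc ?w (rev is) \<and> t 5 = Num (S (j # js)) \<and> sized B t)"
    if "?Inv is t \<and> sized B t" for t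
  proof -
    have "val_size (t 17) \<le> B" using that unfolding sized_def by blast
    then have "sized B (t(4 := t 17))" using that by (intro sized_upd) simp_all
    then show ?thesis using that S_eq[OF js' "is"]
      by (intro wp_Assign) (simp_all add: cost_factor_def same_except_def)
  qed
  have "wp update_prog s (1 + (1 + ((2 + length is * (4 + 3)) + 1))) (\<lambda>t. same_except {4, 5, 8, 9, 10, 17} s t \<and>
      t 4 = enc ?w (rev is) \<and> t 5 = Num (S (j # js)) \<and> sized B t)"
    unfolding update_prog_def
    by (intro wp_Seq wp_Assign s(1) sized_upd)
      (use zero wp_conseq[OF loop le_refl last] in \<open>simp_all add: cost_factor_def floorlog_def\<close>)
  then show ?thesis by (rule wp_conseq) simp_all
qed

lemma wp_merge:
  assumes s: "sized B s" "s 13 = enc (Y js) ks" "s 14 = Num (D js)" "s 7 = Num (of_nat j)" "s 11 = Num (M j)"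
    and js: "set js \<subseteq> J" "length js < T" and j: "j \<in> J" "val_size (Num (of_nat j)) \<le> R"
    and ks: "distinct ks" "set ks = set js" "\<And>k. k \<in> set js \<Longrightarrow> val_size (Num (of_nat k)) \<le> R"
  shows "wp merge_prog s (6 + T * 5)
    (\<lambda>t. same_except {8, 9, 13, 14, 17, 18} s t \<and>
      t 13 = enc (Y (j # js)) (j # rev (filter (\<lambda>k. k \<noteq> j) ks)) \<and> t 14 = Num (D (j # js)) \<and> sized B t)"
proof -
  let ?d = "1 / M j"
  \<comment> \<open>Variable 18 starts with the step size and picks up the old entry when an earlier
    occurrence of j is met.\<close>
  let ?q = "\<lambda>pre. ?d + (if j \<in> set pre then Y js j else 0)"
  let ?r = "\<lambda>pre. rev (filter (\<lambda>k. k \<noteq> j) pre)"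
  let ?Z = "{8, 9, 13, 14, 17, 18}"
  let ?Inv = "\<lambda>pre t. same_except ?Z s t \<and> t 14 = Num (D (j # js)) \<and> t 17 = enc (Y js) (?r pre) \<and> t 18 = Num (?q pre)"
  \<comment> \<open>Inequality of indices is expressed by the two strict comparisons: their sum is
    nonzero exactly when the indices differ.\<close>
  let ?test = "Plus (Less (Fst (Var 9)) (Var 7)) (Less (Var 7) (Fst (Var 9)))"
  let ?keep = "Assign 17 (MkPair (Var 9) (Var 17))" and ?add = "Assign 18 (Plus (Var 18) (Snd (Var 9)))"
  let ?c = "If ?test ?keep ?add"
  let ?s = "s(18 := Num ?d, 14 := Num (D (j # js)), 17 := Num 0)"
  have js': "set (j # js) \<subseteq> J" "length (j # js) \<le> T" and jsT: "length js \<le> T" using js j by simp_all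
  have Yb: "bits (Y js k) \<le> b" "bits (Y (j # js) k) \<le> b" for k
    by (rule le_trans[OF Y_bits[OF js(1) jsT] b_ge_Y], rule le_trans[OF Y_bits[OF js'] b_ge_Y])
  have Y_new: "?d + Y js j = Y (j # js) j" by (simp add: Y_Cons)
  have db: "val_size (Num ?d) \<le> B" using step_bits[OF js' j(1)] a_le_b by (intro num_le_B) simp
  have qb: "val_size (Num (?q pre)) \<le> B" for pre
    using db Yb(2)[of j] Y_new num_le_B by (cases "j \<in> set pre") simp_all
  have Db: "val_size (Num (D (j # js))) \<le> B" by (intro num_le_B le_trans[OF D_bits[OF js'] b_ge_Y])
  have zero: "val_size (Num 0) \<le> B" using B_ge by simp
  have lenks: "length ks \<le> length js" using ks(1,2) by (metis card_length distinct_card)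
  have encY: "val_size (enc f ls) \<le> B" if "set ls \<subseteq> insert j (set js)" "length ls \<le> T" "\<And>k. bits (f k) \<le> b" for f ls
  proof -
    have "val_size (Num (of_nat k)) \<le> R" if "k \<in> insert j (set js)" for k using that ks(3) j(2) by auto
    then show ?thesis using that by (intro enc_le_B) (blast intro: trans_le_add1, auto)
  qed
  have sz: "sized B (s(18 := Num ?d))" "sized B (s(18 := Num ?d, 14 := Num (D (j # js))))" "sized B ?s"
    by (intro sized_upd zero s(1) db Db)+
  have loop: "wp (foreach (Var 13) ?c) ?s (2 + length ks * (2 + 3)) (\<lambda>t. ?Inv ks t \<and> sized B t)"
  proof (rule wp_foreach[where f = "Y js"])
    show "val_size (enc (Y js) ks) \<le> B" using s(1,2) unfolding sized_def by metis
    show "sized B ?s" by (rule sz(3))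
  next
    fix pre i rest t
    assume split: "ks = pre @ i # rest" and Inv: "?Inv pre t" and t: "sized B t"
      and t9: "t 9 = Pair (Num (of_nat i)) (Num (Y js i))"
    have t7: "t 7 = Num (of_nat j)" using Inv s(4) by (simp add: same_except_def)
    let ?P = "\<lambda>t'. ?Inv (pre @ [i]) t' \<and> t' 8 = t 8 \<and> sized B t'"
    have "wp ?c t (1 + 1) ?P"
    proof (rule wp_If[OF t])
      assume "eval ?test t \<noteq> Num 0"
      then have ij: "i \<noteq> j" using t9 t7 by (auto split: if_splits)
      have "length (?r (pre @ [i])) \<le> length (pre @ [i])" by (simp only: length_rev length_filter_le)
      also have "\<dots> \<le> T" using split lenks jsT by simp
      finally have "val_size (enc (Y js) (?r (pre @ [i]))) \<le> B"
        using split ks(2) Yb(1) by (intro encY) auto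
      then have "sized B (t(17 := enc (Y js) (?r (pre @ [i]))))" by (intro sized_upd t)
      then show "wp ?keep t 1 ?P"
        using Inv t9 ij by (intro wp_Assign[OF t]) (simp_all add: cost_factor_def same_except_def)
    next
      assume "eval ?test t = Num 0"
      then have ij: "i = j" using t9 t7 by (auto split: if_splits)
      have "j \<notin> set pre" using split ks(1) ij by auto
      moreover have "sized B (t(18 := Num (?q (pre @ [i]))))" by (intro sized_upd t qb)
      ultimately show "wp ?add t 1 ?P"
        using Inv t9 ij by (intro wp_Assign[OF t]) (simp_all add: cost_factor_def same_except_def)
    qed (simp add: cost_factor_def)
    then show "wp ?c t 2 ?P" by (rule wp_conseq) simp_all
  qed (use s sz in \<open>simp_all add: cost_factor_def same_except_def\<close>)
  let ?Q = "\<lambda>t. same_except ?Z s t \<and> t 13 = enc (Y (j # js)) (j # ?r ks) \<and> t 14 = Num (D (j # js)) \<and> sized B t"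
  have last: "wp (Assign 13 (MkPair (MkPair (Var 7) (Var 18)) (Var 17))) t 1 ?Q"
    if t: "?Inv ks t \<and> sized B t" for t
  proof -
    \<comment> \<open>Playing j changes only the entry of j, which has been filtered out.\<close>
    have "enc (Y js) (?r ks) = enc (Y (j # js)) (?r ks)"
      unfolding enc_def by (intro arg_cong[where f = encode_sparse] map_cong) (auto simp: Y_Cons)
    moreover have "?q ks = Y (j # js) j" using ks(2) Y_eq_0[of j js] by (simp add: Y_Cons)
    moreover have "t 7 = Num (of_nat j)" using t s(4) by (simp add: same_except_def)
    ultimately have e: "Pair (Pair (t 7) (t 18)) (t 17) = enc (Y (j # js)) (j # ?r ks)" using t by simp
    have "length (j # ?r ks) \<le> T" using js(2) le_trans[OF length_filter_le[of "\<lambda>k. k \<noteq> j" ks] lenks] by simp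
    then have "val_size (enc (Y (j # js)) (j # ?r ks)) \<le> B" using ks(2) Yb(2) by (intro encY) auto
    then have "sized B (t(13 := enc (Y (j # js)) (j # ?r ks)))" using t by (intro sized_upd) simp_all
    then show ?thesis using t e
      by (intro wp_Assign) (simp_all add: cost_factor_def same_except_def)
  qed
  have loop': "wp (Seq (foreach (Var 13) ?c) (Assign 13 (MkPair (MkPair (Var 7) (Var 18)) (Var 17)))) ?s
      ((2 + length ks * (2 + 3)) + 1) ?Q"
    by (rule wp_Seq[OF wp_conseq[OF loop le_refl last]])
  have e: "eval (Divide (Const (Num 1)) (Var 11)) s = Num ?d"
    "eval (Plus (Var 18) (Var 14)) (s(18 := Num ?d)) = Num (D (j # js))"
    using s(3,5) by (simp_all add: D_Cons)
  have "wp merge_prog s (1 + (1 + (1 + ((2 + length ks * (2 + 3)) + 1)))) ?Q"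
    unfolding merge_prog_def
  proof (rule wp_Seq, rule wp_Assign[OF s(1)], goal_cases)
    case 2
    show ?case unfolding e(1)
    proof (rule wp_Seq, rule wp_Assign[OF sz(1)], goal_cases)
      case 2
      show ?case unfolding e(2)
      proof (rule wp_Seq, rule wp_Assign[OF sz(2)], goal_cases)
        case 2
        show ?case unfolding eval.simps(1) by (rule loop')
      qed (simp add: cost_factor_def)
    qed (simp add: cost_factor_def)
  qed (simp add: cost_factor_def)
  moreover have "length ks * 5 \<le> T * 5" using lenks jsT by simp
  ultimately show ?thesis by (elim wp_conseq) simp_all
qed

lemma wp_weights:
  assumes s: "sized B s" "s 12 = Num (of_nat k)" "s 4 = enc (W []) [k..<n]" and k: "k \<le> n"
  shows "wp weights_prog s (1 + k * 3)
    (\<lambda>t. same_except {4, 12} s t \<and> t 4 = enc (W []) [0..<n] \<and> sized B t)"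
  using assms
proof (induction k arbitrary: s)
  case 0
  then show ?case unfolding weights_prog_def
    by (intro wp_conseq[OF wp_While_False]) (simp_all add: cost_factor_def same_except_def floorlog_def)
next
  case (Suc k)
  let ?s1 = "s(12 := Num (of_nat k))"
  let ?s2 = "?s1(4 := enc (W []) [k..<n])"
  have "val_size (Num (of_nat k)) \<le> B"
    using bits_of_nat[of k] Suc.prems(4) b_ge(4) by (intro num_le_B) simp
  then have s1: "sized B ?s1" by (intro sized_upd Suc.prems(1))
  have "val_size (enc (W []) [k..<n]) \<le> B" using a_le_b by (intro enc_rows_le_B) (auto simp: W_Nil)
  then have s2: "sized B ?s2" by (intro sized_upd s1)
  have up: "[k..<n] = k # [Suc k..<n]" using Suc.prems(4) by (simp add: upt_conv_Cons)
  have e1: "eval (Minus (Var 12) (Const (Num 1))) s = Num (of_nat k)" using Suc.prems(2) by simp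
  have e2: "eval (MkPair (MkPair (Var 12) (Const (Num 1))) (Var 4)) ?s1 = enc (W []) [k..<n]"
    using Suc.prems(3) unfolding up by (simp add: W_Nil[of k])
  have fac: "cost_factor (Minus (Var 12) (Const (Num 1))) \<le> 900"
    "cost_factor (MkPair (MkPair (Var 12) (Const (Num 1))) (Var 4)) \<le> 900"
    "cost_factor (Less (Const (Num 0)) (Var 12)) \<le> 900"
    by (simp_all add: cost_factor_def floorlog_def)
  let ?P = "\<lambda>t. same_except {4, 12} s t \<and> t 4 = enc (W []) [0..<n] \<and> sized B t"
  have "wp weights_prog ?s2 (1 + k * 3) (\<lambda>t. same_except {4, 12} ?s2 t \<and> t 4 = enc (W []) [0..<n] \<and> sized B t)"
    by (rule Suc.IH[OF s2]) (use Suc.prems(4) in simp_all)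
  then have "wp weights_prog ?s2 (1 + k * 3) ?P"
    by (rule wp_conseq) (auto simp: same_except_def)
  then have "wp weights_prog s (1 + (1 + 1) + (1 + k * 3)) ?P"
    unfolding weights_prog_def
    by (intro wp_While_True wp_Seq wp_Assign fac Suc.prems(1))
      (unfold e1 e2, use Suc.prems(2) s1 in \<open>simp_all del: eval.simps(3,8)\<close>)
  then show ?case by (rule wp_conseq) simp_all
qed

section \<open>The loop over the rounds and the complete program\<close>

text \<open>Traversals reverse lists, so the order of entries is left existential. The last
  disjunction separates the start, where variable 16 holds no strategy yet.\<close>

definition round_inv :: "nat list \<Rightarrow> store \<Rightarrow> bool" where
  "round_inv js t \<longleftrightarrow> sized B t \<and> set js \<subseteq> J \<and> length js \<le> T \<and>
     (\<forall>k\<in>set js. val_size (Num (of_nat k)) \<le> R) \<and> (\<forall>(js', j)\<in>rounds js. G js' j) \<and>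
     t 2 = Num (of_nat H) \<and> t 3 = Num (of_nat (T - length js)) \<and>
     (\<exists>is. distinct is \<and> set is = {..<n} \<and> t 4 = enc (W js) is) \<and> t 5 = Num (S js) \<and>
     (\<exists>ks. distinct ks \<and> set ks = set js \<and> t 13 = enc (Y js) ks) \<and> t 14 = Num (D js) \<and>
     (\<exists>q. t 15 = Num q \<and> (\<forall>(js', j)\<in>rounds js. V js' j \<le> q) \<and>
        (js = [] \<and> q = 0 \<or> (\<exists>js' j is. (js', j) \<in> rounds js \<and> q = V js' j \<and> distinct is \<and>
           set is = {..<n} \<and> t 16 = enc (X js') is)))"

lemma wp_record:
  assumes "sized B s" "s 15 = Num q" "s 12 = Num v"
  shows "wp record_prog s 3 (\<lambda>t. same_except {15, 16} s t \<and> sized B t \<and>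
    t 15 = Num (max q v) \<and> t 16 = (if q < v then s 6 else s 16))"
proof -
  have sz: "sized B (s(15 := s 12))" "sized B (s(15 := s 12, 16 := s 6))"
    using assms(1) by (simp_all add: sized_def)
  have "wp record_prog s (1 + (1 + 1)) (\<lambda>t. same_except {15, 16} s t \<and> sized B t \<and>
    t 15 = Num (max q v) \<and> t 16 = (if q < v then s 6 else s 16))"
    unfolding record_prog_def
  proof (rule wp_If[OF assms(1)], goal_cases)
    case 1
    then show ?case by (simp add: cost_factor_def)
  next
    case 2
    then have "q < v" using assms by (simp split: if_splits)
    then show ?case using assms sz
      by (intro wp_Seq wp_Assign) (simp_all add: cost_factor_def same_except_def max_def)
  next
    case 3
    then have "\<not> q < v" using assms by (simp split: if_splits)
    then show ?case using assms
      by (intro wp_conseq[OF wp_Skip]) (simp_all add: same_except_def max_def)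
  qed
  then show ?thesis by (simp add: numeral_3_eq_3)
qed

lemma wp_round:
  assumes inv: "round_inv js s" and len: "length js < T"
  shows "wp round_prog s (30 + n * 18 + T * 5) (\<lambda>t. \<exists>j. round_inv (j # js) t)"
proof -
  obtain "is" ks q where s: "sized B s" "set js \<subseteq> J" "\<forall>k\<in>set js. val_size (Num (of_nat k)) \<le> R"
    "\<forall>(js', j)\<in>rounds js. G js' j"
    "s 2 = Num (of_nat H)" "s 3 = Num (of_nat (T - length js))"
    and "is": "distinct is" "set is = {..<n}" "s 4 = enc (W js) is"
    and s5: "s 5 = Num (S js)"
    and ks: "distinct ks" "set ks = set js" "s 13 = enc (Y js) ks" and s14: "s 14 = Num (D js)"
    and q: "s 15 = Num q" "\<forall>(js', j)\<in>rounds js. V js' j \<le> q"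
      "js = [] \<and> q = 0 \<or> (\<exists>js' j is. (js', j) \<in> rounds js \<and> q = V js' j \<and> distinct is \<and>
           set is = {..<n} \<and> s 16 = enc (X js') is)"
    using inv unfolding round_inv_def by (elim conjE exE) (rule that)
  have lenT: "length js \<le> T" using len by simp
  have lis: "length is = n" using "is" distinct_card[of "is"] by simp
  obtain k j where j: "computes \<Gamma> (\<Gamma> BestResponse) (enc (X js) (rev is)) k (Num (of_nat j))" "k \<le> R"
    "val_size (Num (of_nat j)) \<le> R" "j \<in> J" "G js j"
    using best_response[OF s(2) len, of "rev is"] "is" by auto
  have Vpos: "V js j > 0" by (rule V_pos[OF s(2) j(4)])
  let ?s1 = "s(3 := Num (of_nat (T - length (j # js))))"
  have "val_size (Num (of_nat (T - length (j # js)))) \<le> B"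
    using bits_of_nat[of "T - length (j # js)"] b_ge(3) by (intro num_le_B) linarith
  then have s1: "sized B ?s1" by (intro sized_upd s(1))
  have e1: "eval (Minus (Var 3) (Const (Num 1))) s = Num (of_nat (T - length (j # js)))"
    using s(6) len by (simp add: of_nat_diff)
  have Xeq: "(\<lambda>i. W js i / S js) = X js" by (simp add: X_def fun_eq_iff)
  have encX: "val_size (enc (X js) is) \<le> B"
    using X_bits_le[OF s(2) lenT] "is" by (intro enc_rows_le_B) auto
  let ?Q = "\<lambda>t. \<exists>j. round_inv (j # js) t"
  \<comment> \<open>The facts 8, 7, 6, 5 and 3 treat the round backwards from its last statement,
    each for an arbitrary store with the required values in the variables that the remaining
    statements and the invariant refer to.\<close>
  have 8: "wp record_prog t 3 ?Q"
    if t: "sized B t" "t 2 = s 2" "t 3 = ?s1 3" "t 4 = enc (W (j # js)) (rev is)" "t 5 = Num (S (j # js))"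
      "t 6 = enc (X js) (rev is)" "t 12 = Num (V js j)" "t 13 = enc (Y (j # js)) (j # rev (filter (\<lambda>k. k \<noteq> j) ks))"
      "t 14 = Num (D (j # js))" "t 15 = s 15" "t 16 = s 16" for t
  proof (rule wp_conseq[OF wp_record])
    show "sized B t" "t 15 = Num q" "t 12 = Num (V js j)" using t q by simp_all
    fix t' assume t': "same_except {15, 16} t t' \<and> sized B t' \<and> t' 15 = Num (max q (V js j)) \<and>
      t' 16 = (if q < V js j then t 6 else t 16)"
    then have eqs: "t' x = t x" if "x \<notin> {15, 16}" for x using that by (simp add: same_except_def)
    have "\<exists>js' j' is. (js', j') \<in> rounds (j # js) \<and> max q (V js j) = V js' j' \<and> distinct is \<and>
           set is = {..<n} \<and> t' 16 = enc (X js') is"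
    proof (cases "q < V js j")
      case True
      then show ?thesis using t' t(6) "is" by (intro exI[of _ js] exI[of _ j] exI[of _ "rev is"]) simp
    next
      case False
      \<comment> \<open>Before the first round q = 0, which the positive payoff would have
        beaten.\<close>
      have "js \<noteq> []"
      proof
        assume "js = []"
        then have "q = 0" using q(3) by (elim disjE exE conjE) simp_all
        then show "False" using False Vpos by simp
      qed
      then obtain js' j' ls where "(js', j') \<in> rounds js" "q = V js' j'" "distinct ls" "set ls = {..<n}"
        "s 16 = enc (X js') ls"
        using q(3) by (elim disjE exE conjE) (simp, rule that)
      then show ?thesis using False t' t(11)
        by (intro exI[of _ js'] exI[of _ j'] exI[of _ ls]) simp
    qed
    then have best: "\<exists>q'. t' 15 = Num q' \<and> (\<forall>(js', j')\<in>rounds (j # js). V js' j' \<le> q') \<and>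
        (j # js = [] \<and> q' = 0 \<or> (\<exists>js' j' is. (js', j') \<in> rounds (j # js) \<and> q' = V js' j' \<and> distinct is \<and>
           set is = {..<n} \<and> t' 16 = enc (X js') is))"
      using t' q(2) by (intro exI[of _ "max q (V js j)"]) auto
    have Y': "distinct (j # rev (filter (\<lambda>k. k \<noteq> j) ks))" "set (j # rev (filter (\<lambda>k. k \<noteq> j) ks)) = set (j # js)"
      "t' 13 = enc (Y (j # js)) (j # rev (filter (\<lambda>k. k \<noteq> j) ks))"
      using ks t(8) eqs[of 13] by auto
    have W': "distinct (rev is)" "set (rev is) = {..<n}" "t' 4 = enc (W (j # js)) (rev is)"
      using "is" t(4) eqs[of 4] by simp_all
    have simple: "sized B t'" "set (j # js) \<subseteq> J" "length (j # js) \<le> T"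
      "\<forall>k\<in>set (j # js). val_size (Num (of_nat k)) \<le> R" "\<forall>(js', j)\<in>rounds (j # js). G js' j"
      "t' 2 = Num (of_nat H)" "t' 3 = Num (of_nat (T - length (j # js)))"
      "t' 5 = Num (S (j # js))" "t' 14 = Num (D (j # js))"
      using t' s j len t eqs[of 2] eqs[of 3] eqs[of 5] eqs[of 14] by simp_all
    have "round_inv (j # js) t'"
      unfolding round_inv_def using simple best W' Y' by (intro conjI) (assumption | blast)+
    then show "?Q t'" by blast
  qed simp
  have 7: "wp (Seq merge_prog record_prog) t (6 + T * 5 + 3) ?Q"
    if t: "sized B t" "t 2 = s 2" "t 3 = ?s1 3" "t 4 = enc (W (j # js)) (rev is)" "t 5 = Num (S (j # js))"
      "t 6 = enc (X js) (rev is)" "t 7 = Num (of_nat j)" "t 11 = Num (M j)" "t 12 = Num (V js j)"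
      "t 13 = s 13" "t 14 = s 14" "t 15 = s 15" "t 16 = s 16" for t
  proof (rule wp_Seq, rule wp_conseq[OF wp_merge])
    show "sized B t" "t 13 = enc (Y js) ks" "t 14 = Num (D js)" "t 7 = Num (of_nat j)" "t 11 = Num (M j)"
      using t ks s14 by simp_all
  qed (use t s(2,3) len j ks in \<open>auto intro!: 8 simp: same_except_def simp del: enc_simps\<close>)
  have 6: "wp (Seq update_prog (Seq merge_prog record_prog)) t ((5 + length is * 7) + (6 + T * 5 + 3)) ?Q"
    if t: "sized B t" "t 2 = s 2" "t 3 = ?s1 3" "t 4 = s 4" 
      "t 6 = enc (X js) (rev is)" "t 7 = Num (of_nat j)" "t 11 = Num (M j)" "t 12 = Num (V js j)"
      "t 13 = s 13" "t 14 = s 14" "t 15 = s 15" "t 16 = s 16" for t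
  proof (rule wp_Seq, rule wp_conseq[OF wp_update])
    show "sized B t" "t 4 = enc (W js) is" "t 7 = Num (of_nat j)" "t 11 = Num (M j)" "t 2 = Num (of_nat H)"
      using t "is" s by simp_all
    fix t' assume t': "same_except {4, 5, 8, 9, 10, 17} t t' \<and> t' 4 = enc (W (j # js)) (rev is) \<and>
      t' 5 = Num (S (j # js)) \<and> sized B t'"
    then have eqs: "t' x = t x" if "x \<notin> {4, 5, 8, 9, 10, 17}" for x using that by (simp add: same_except_def)
    show "wp (Seq merge_prog record_prog) t' (6 + T * 5 + 3) ?Q"
      by (rule 7) (use t t' eqs in simp_all)
  qed (use s(2) len j(4) "is" in simp_all)
  have 5: "wp (Seq scan_prog (Seq update_prog (Seq merge_prog record_prog))) t
      ((4 + length (rev is) * 7) + ((5 + length is * 7) + (6 + T * 5 + 3))) ?Q"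
    if t: "sized B t" "t 2 = s 2" "t 3 = ?s1 3" "t 4 = s 4" "t 6 = enc (X js) (rev is)" "t 7 = Num (of_nat j)"
      "t 13 = s 13" "t 14 = s 14" "t 15 = s 15" "t 16 = s 16" for t
  proof (rule wp_Seq, rule wp_conseq[OF wp_scan])
    show "sized B t" "t 6 = enc (X js) (rev is)" "t 7 = Num (of_nat j)" by (rule t)+
    fix t' assume t': "same_except {8, 9, 10, 11, 12} t t' \<and> t' 11 = Num (M j) \<and> t' 12 = Num (V js j) \<and> sized B t'"
    then have eqs: "t' x = t x" if "x \<notin> {8, 9, 10, 11, 12}" for x using that by (simp add: same_except_def)
    show "wp (Seq update_prog (Seq merge_prog record_prog)) t' ((5 + length is * 7) + (6 + T * 5 + 3)) ?Q"
      by (rule 6) (use t t' eqs in simp_all)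
  qed (use s(2) lenT j(4) "is" in simp_all)
  let ?rest = "Seq (Assign 6 (Var 17)) (Seq (Call 7 BestResponse (Var 6))
     (Seq scan_prog (Seq update_prog (Seq merge_prog record_prog))))"
  let ?k = "1 + (1 + ((4 + length (rev is) * 7) + ((5 + length is * 7) + (6 + T * 5 + 3))))"
  have 3: "wp ?rest t ?k ?Q"
    if t: "sized B t" "same_except {8, 9, 17} ?s1 t" "t 17 = enc (X js) (rev is)" for t
  proof -
    have eqs: "t x = ?s1 x" if "x \<notin> {8, 9, 17}" for x using t(2) that by (simp add: same_except_def)
    let ?t1 = "t(6 := enc (X js) (rev is))"
    let ?t2 = "?t1(7 := Num (of_nat j))"
    have t1: "sized B ?t1" using encX by (intro sized_upd t(1)) (simp only: val_size_enc_rev)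
    have jB: "val_size (Num (of_nat j)) \<le> B" using j(3) R_le_B by (rule le_trans)
    have t2: "sized B ?t2" by (intro sized_upd t1 jB)
    have "wp (Seq scan_prog (Seq update_prog (Seq merge_prog record_prog))) ?t2
      ((4 + length (rev is) * 7) + ((5 + length is * 7) + (6 + T * 5 + 3))) ?Q"
      by (rule 5) (use t t2 eqs in simp_all)
    then have "wp (Call 7 BestResponse (Var 6)) ?t1 1
      (\<lambda>t. wp (Seq scan_prog (Seq update_prog (Seq merge_prog record_prog))) t
        ((4 + length (rev is) * 7) + ((5 + length is * 7) + (6 + T * 5 + 3))) ?Q)"
      using j(1,2) jB t1 by (intro wp_Call[where k = k and v = "Num (of_nat j)"])
        (simp_all only: eval.simps fun_upd_same, simp add: cost_factor_def)
    from wp_Seq[OF this] show ?thesis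
      using t(3) by (intro wp_Seq[of "Assign 6 (Var 17)"] wp_Assign[OF t(1)])
        (simp_all only: eval.simps, simp add: cost_factor_def)
  qed
  have "wp round_prog s (1 + ((3 + length is * 4) + ?k)) ?Q"
    unfolding round_prog_def
  proof (rule wp_Seq, rule wp_Assign[OF s(1)])
    show "wp (Seq (normalize_prog 4 5) ?rest) (s(3 := eval (Minus (Var 3) (Const (Num 1))) s))
        ((3 + length is * 4) + ?k) ?Q"
      unfolding e1
    proof (rule wp_Seq, rule wp_conseq[OF wp_normalize[where f = "W js" and q = "S js"]])
      show "val_size (enc (\<lambda>i. W js i / S js) is) \<le> B" unfolding Xeq by (rule encX)
      show "sized B ?s1" by (rule s1)
      fix t assume "same_except {8, 9, 17} ?s1 t \<and> t 17 = enc (\<lambda>i. W js i / S js) (rev is) \<and> sized B t"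
      then show "wp ?rest t ?k ?Q" unfolding Xeq by (intro 3) simp_all
    qed (use "is" s5 in simp_all)
  qed (simp add: cost_factor_def)
  then show ?thesis by (rule wp_conseq) (simp_all add: lis)
qed

lemma wp_rounds:
  assumes "round_inv js s"
  shows "wp (While (Less (Const (Num 0)) (Var 3)) round_prog) s
    (1 + (T - length js) * (31 + n * 18 + T * 5)) (\<lambda>t. \<exists>js. length js = T \<and> round_inv js t)"
  using assms
proof (induction "T - length js" arbitrary: js s)
  case 0
  then have "length js = T" "sized B s" "s 3 = Num 0" by (simp_all add: round_inv_def)
  then show ?case using 0(2) by (intro wp_conseq[OF wp_While_False[where P = "\<lambda>t. t = s"]])
    (auto simp: cost_factor_def)
next
  case (Suc d)
  have len: "length js < T" using Suc.hyps(2) by simp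
  have s: "sized B s" "s 3 = Num (of_nat (T - length js))" using Suc.prems by (simp_all add: round_inv_def)
  let ?loop = "While (Less (Const (Num 0)) (Var 3)) round_prog"
  let ?P = "\<lambda>t. \<exists>js. length js = T \<and> round_inv js t"
  let ?K = "31 + n * 18 + T * 5"
  have "wp round_prog s (30 + n * 18 + T * 5) (\<lambda>t. wp ?loop t (1 + d * ?K) ?P)"
  proof (rule wp_conseq[OF wp_round[OF Suc.prems len] le_refl], elim exE)
    fix t j assume "round_inv (j # js) t"
    moreover have d: "d = T - length (j # js)" using Suc.hyps(2) by simp
    ultimately have "wp ?loop t (1 + (T - length (j # js)) * ?K) ?P" by (intro Suc.hyps(1))
    then show "wp ?loop t (1 + d * ?K) ?P" unfolding d[symmetric] .
  qed
  then have "wp ?loop s (1 + (30 + n * 18 + T * 5) + (1 + d * ?K)) ?P"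
    using len s by (intro wp_While_True[OF s(1)]) (simp_all add: cost_factor_def)
  then show ?case by (rule wp_conseq) (simp_all add: Suc.hyps(2)[symmetric])
qed

lemma wp_init:
  assumes s: "sized B s" "s 0 = Pair (Num (of_nat n)) (Num (of_nat N))" "\<And>x. x \<noteq> 0 \<Longrightarrow> s x = Num 0"
  shows "wp init_prog s (5 + n * 3) (round_inv [])"
proof -
  let ?s1 = "s(2 := Num (of_nat H))"
  let ?s2 = "?s1(3 := Num (of_nat T))"
  let ?s3 = "?s2(5 := Num (of_nat n))"
  let ?s4 = "?s3(12 := Num (of_nat n))"
  have B: "val_size (Num (of_nat k)) \<le> B" if "k + 1 \<le> b" for k
    using bits_of_nat[of k] that by (intro num_le_B) linarith
  have sz1: "sized B ?s1" by (intro sized_upd s(1) B b_ge(5))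
  have sz2: "sized B ?s2" by (intro sized_upd sz1 B b_ge(3))
  have sz3: "sized B ?s3" by (intro sized_upd sz2 B b_ge(4))
  have sz4: "sized B ?s4" by (intro sized_upd sz3 B b_ge(4))
  have T_eq: "of_nat T = (of_nat n * (of_nat n * (of_nat H * of_nat H)) :: rat)" by (simp add: T_def mult.assoc)
  have e: "eval (Times (Const (Num 2)) (Plus (Snd (Var 0)) (Const (Num 1)))) s = Num (of_nat H)"
    "eval (Times (Fst (Var 0)) (Times (Fst (Var 0)) (Times (Var 2) (Var 2)))) ?s1 = Num (of_nat T)"
    "eval (Fst (Var 0)) ?s2 = Num (of_nat n)" "eval (Fst (Var 0)) ?s3 = Num (of_nat n)"
    using s(2) unfolding T_eq by (simp_all add: H_def)
  have w: "wp weights_prog ?s4 (1 + n * 3) (round_inv [])"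
  proof (rule wp_conseq[OF wp_weights[OF sz4 _ _ le_refl] le_refl])
    fix t assume t: "same_except {4, 12} ?s4 t \<and> t 4 = enc (W []) [0..<n] \<and> sized B t"
    then have eqs: "t x = ?s4 x" if "x \<notin> {4, 12}" for x using that by (simp add: same_except_def)
    have "S [] = of_nat n" by (simp add: S_def W_Nil)
    moreover have "set [0..<n] = {..<n}" by auto
    \<comment> \<open>The default \<open>Num 0\<close> is both the empty list for 13 and the number
      zero for 14 and 15.\<close>
    ultimately show "round_inv [] t"
      unfolding round_inv_def using t s(3) eqs[of 2] eqs[of 3] eqs[of 5] eqs[of 13] eqs[of 14] eqs[of 15]
      by (intro conjI exI[of _ "[0..<n]"] exI[of _ "[] :: nat list"] exI[of _ "0 :: rat"]) simp_all
  qed (use s(3) in simp_all)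
  have "wp init_prog s (1 + (1 + (1 + (1 + (1 + n * 3))))) (round_inv [])"
    unfolding init_prog_def
  proof (rule wp_Seq, rule wp_Assign[OF s(1)], goal_cases)
    case 2
    show ?case unfolding e(1)
    proof (rule wp_Seq, rule wp_Assign[OF sz1], goal_cases)
      case 2
      show ?case unfolding e(2)
      proof (rule wp_Seq, rule wp_Assign[OF sz2], goal_cases)
        case 2
        show ?case unfolding e(3)
          by (rule wp_Seq, rule wp_Assign[OF sz3]) (simp add: cost_factor_def, unfold e(4), rule w)
      qed (simp add: cost_factor_def)
    qed (simp add: cost_factor_def)
  qed (simp add: cost_factor_def val_size.simps floorlog_def)
  then show ?thesis by (rule wp_conseq) simp_all
qed

definition solved :: "store \<Rightarrow> bool" where
  "solved t \<longleftrightarrow> (\<exists>js ks ls js0 j0. length js = T \<and> set js \<subseteq> J \<and> (\<forall>(js', j)\<in>rounds js. G js' j) \<and>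
     distinct ks \<and> set ks = set js \<and> t 17 = enc (\<lambda>k. Y js k / D js) ks \<and>
     (js0, j0) \<in> rounds js \<and> (\<forall>(js', j)\<in>rounds js. V js' j \<le> V js0 j0) \<and>
     distinct ls \<and> set ls = {..<n} \<and> t 16 = enc (X js0) ls)"

lemma wp_solver:
  assumes "sized B s" "s 0 = Pair (Num (of_nat n)) (Num (of_nat N))" "\<And>x. x \<noteq> 0 \<Longrightarrow> s x = Num 0"
  shows "wp solver_prog s (9 + n * 3 + T * (35 + n * 18 + T * 5)) (\<lambda>t. solved t \<and> sized B t)"
proof -
  let ?loop = "While (Less (Const (Num 0)) (Var 3)) round_prog"
  let ?Q = "\<lambda>t. solved t \<and> sized B t"
  have final: "wp (normalize_prog 13 14) t (3 + T * 4) ?Q" if "length js = T" "round_inv js t" for js t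
  proof -
    from that(2) obtain ks q where t: "sized B t" "set js \<subseteq> J" "length js \<le> T"
      "\<forall>k\<in>set js. val_size (Num (of_nat k)) \<le> R" "\<forall>(js', j)\<in>rounds js. G js' j" "t 14 = Num (D js)"
      and ks: "distinct ks" "set ks = set js" "t 13 = enc (Y js) ks"
      and q: "\<forall>(js', j)\<in>rounds js. V js' j \<le> q"
        "js = [] \<and> q = 0 \<or> (\<exists>js' j is. (js', j) \<in> rounds js \<and> q = V js' j \<and> distinct is \<and>
           set is = {..<n} \<and> t 16 = enc (X js') is)"
      unfolding round_inv_def by (elim conjE exE) (rule that)
    have "js \<noteq> []" using that(1) T_pos by auto
    then obtain js0 j0 ls where x: "(js0, j0) \<in> rounds js" "q = V js0 j0" "distinct ls"
      "set ls = {..<n}" "t 16 = enc (X js0) ls"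
      using q(2) by (elim disjE exE conjE) (simp, rule that)
    have len: "length ks \<le> T" using ks(1,2) t(3) by (metis card_length distinct_card le_trans)
    \<comment> \<open>A quotient of two numbers of length \<open>T * (a + 2) + 1\<close>, hence the
      factor 2 in the assumption on b.\<close>
    have YD: "bits (Y js k / D js) \<le> b" for k
      using bits_divide[of "Y js k" "D js"] Y_bits[OF t(2,3), of k] D_bits[OF t(2,3)] b_ge(2)
      unfolding mult_2 by linarith
    have "val_size (enc (\<lambda>k. Y js k / D js) ks) \<le> B"
      using ks(2) t(4) len YD by (intro enc_le_B) (auto intro: trans_le_add1)
    then show ?thesis
    proof (intro wp_conseq[OF wp_normalize[OF t(1) ks(3) t(6)]])
      fix t' assume t': "same_except {8, 9, 17} t t' \<and> t' 17 = enc (\<lambda>k. Y js k / D js) (rev ks) \<and> sized B t'"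
      then have "t' 16 = t 16" by (simp add: same_except_def)
      moreover have "\<forall>(js', j)\<in>rounds js. V js' j \<le> V js0 j0" using q(1) x(2) by simp
      ultimately have "solved t'" unfolding solved_def
        using that(1) t' t(2,5) ks x
        by (intro exI[of _ js] exI[of _ "rev ks"] exI[of _ ls] exI[of _ js0] exI[of _ j0] conjI) simp_all
      then show "?Q t'" using t' by simp
    qed (use len in simp_all)
  qed
  have loop: "wp (Seq ?loop (normalize_prog 13 14)) t ((1 + T * (31 + n * 18 + T * 5)) + (3 + T * 4)) ?Q"
    if "round_inv [] t" for t
    using wp_rounds[OF that] by (intro wp_Seq) (erule wp_conseq, simp, use final in blast)
  have init: "wp init_prog s (5 + n * 3) (round_inv [])" using assms by (rule wp_init)
  have "wp solver_prog s ((5 + n * 3) + ((1 + T * (31 + n * 18 + T * 5)) + (3 + T * 4))) ?Q"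
    unfolding solver_prog_def
    by (rule wp_Seq, rule wp_conseq[OF init le_refl]) (rule loop)
  then show ?thesis by (rule wp_conseq) (simp_all add: algebra_simps)
qed

end

section \<open>Polynomial bounds\<close>

text \<open>The base n + m + 1 is at least 1, so exponents can be raised to a common one; this makes
  closure under sums and products immediate.\<close>

definition poly_bounded :: "(nat \<Rightarrow> nat \<Rightarrow> nat) \<Rightarrow> bool" where
  "poly_bounded f \<longleftrightarrow> (\<exists>c e. \<forall>n m. f n m \<le> c * (n + m + 1) ^ e)"

lemma poly_boundedI: "(\<And>n m. f n m \<le> c * (n + m + 1) ^ e) \<Longrightarrow> poly_bounded f"
  unfolding poly_bounded_def by blast

lemma poly_bounded_const: "poly_bounded (\<lambda>n m. k)"
  by (rule poly_boundedI[of _ k 0]) simp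

lemma poly_bounded_args: "poly_bounded (\<lambda>n m. n)" "poly_bounded (\<lambda>n m. m)"
  by (rule poly_boundedI[of _ 1 1]; simp)+

lemma poly_bounded_add:
  assumes "poly_bounded f" "poly_bounded g"
  shows "poly_bounded (\<lambda>n m. f n m + g n m)"
proof -
  obtain c e c' e' where *: "\<And>n m. f n m \<le> c * (n + m + 1) ^ e" "\<And>n m. g n m \<le> c' * (n + m + 1) ^ e'"
    using assms unfolding poly_bounded_def by blast
  show ?thesis
  proof (rule poly_boundedI)
    fix n m
    have "f n m + g n m \<le> c * (n + m + 1) ^ (e + e') + c' * (n + m + 1) ^ (e + e')"
      by (intro add_mono le_trans[OF *(1)] le_trans[OF *(2)] mult_left_mono power_increasing) simp_all
    then show "f n m + g n m \<le> (c + c') * (n + m + 1) ^ (e + e')" by (simp only: add_mult_distrib)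
  qed
qed

lemma poly_bounded_mult:
  assumes "poly_bounded f" "poly_bounded g"
  shows "poly_bounded (\<lambda>n m. f n m * g n m)"
proof -
  obtain c e c' e' where *: "\<And>n m. f n m \<le> c * (n + m + 1) ^ e" "\<And>n m. g n m \<le> c' * (n + m + 1) ^ e'"
    using assms unfolding poly_bounded_def by blast
  show ?thesis
  proof (rule poly_boundedI)
    fix n m
    have "f n m * g n m \<le> (c * (n + m + 1) ^ e) * (c' * (n + m + 1) ^ e')"
      by (intro mult_mono *) simp_all
    then show "f n m * g n m \<le> (c * c') * (n + m + 1) ^ (e + e')" by (simp only: power_add mult_ac)
  qed
qed

lemma poly_bounded_power: "poly_bounded f \<Longrightarrow> poly_bounded (\<lambda>n m. f n m ^ e)"
  by (induction e) (simp_all add: poly_bounded_const poly_bounded_mult)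

lemmas poly_bounded_intros =
  poly_bounded_const poly_bounded_args poly_bounded_add poly_bounded_mult poly_bounded_power

text \<open>The given time bounds are real polynomials, possibly with negative coefficients. They
  are replaced by monotone bounds, because only an upper bound on the length of a query is
  available.\<close>

lemma poly_le_power:
  fixes p :: "real poly"
  obtains c e :: nat where "\<And>x. x \<ge> 0 \<Longrightarrow> \<bar>poly p x\<bar> \<le> real c * (x + 1) ^ e"
proof -
  have "\<exists>c e :: nat. \<forall>x\<ge>0. \<bar>poly p x\<bar> \<le> real c * (x + 1) ^ e"
  proof (induction p)
    case (pCons a p)
    then obtain c e :: nat where *: "\<And>x. x \<ge> 0 \<Longrightarrow> \<bar>poly p x\<bar> \<le> real c * (x + 1) ^ e" by blast
    obtain k :: nat where k: "\<bar>a\<bar> \<le> real k" using real_arch_simple by blast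
    have "\<bar>poly (pCons a p) x\<bar> \<le> real (k + c) * (x + 1) ^ Suc e" if "x \<ge> 0" for x
    proof -
      have "\<bar>poly (pCons a p) x\<bar> \<le> \<bar>a\<bar> + x * \<bar>poly p x\<bar>"
        using that abs_triangle_ineq[of a "x * poly p x"] by (simp add: abs_mult)
      also have "\<dots> \<le> real k * (x + 1) ^ Suc e + (x + 1) * (real c * (x + 1) ^ e)"
      proof (intro add_mono mult_mono *)
        have "real k * 1 \<le> real k * (x + 1) ^ Suc e"
          using that by (intro mult_left_mono one_le_power) simp_all
        then show "\<bar>a\<bar> \<le> real k * (x + 1) ^ Suc e" using k by simp
      qed (use that in simp_all)
      also have "\<dots> = real (k + c) * (x + 1) ^ Suc e" by (simp add: algebra_simps)
      finally show ?thesis .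
    qed
    then show ?case by blast
  qed simp
  then show ?thesis using that by blast
qed

text \<open>Induction on the outer polynomial, which is the one in y: its leading
  \<open>pCons\<close> contributes a polynomial in x plus y times the rest.\<close>

lemma poly2_le_power:
  obtains c e :: nat where "\<And>x y. x \<ge> 0 \<Longrightarrow> y \<ge> 0 \<Longrightarrow> \<bar>poly2 q x y\<bar> \<le> real c * (x + y + 1) ^ e"
proof -
  have "\<exists>c e :: nat. \<forall>x\<ge>0. \<forall>y\<ge>0. \<bar>poly2 q x y\<bar> \<le> real c * (x + y + 1) ^ e"
  proof (induction q)
    case 0
    then show ?case by (simp add: poly2_def)
  next
    case (pCons a q)
    then obtain c e :: nat where
      *: "\<And>x y. x \<ge> 0 \<Longrightarrow> y \<ge> 0 \<Longrightarrow> \<bar>poly2 q x y\<bar> \<le> real c * (x + y + 1) ^ e" by blast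
    obtain k d :: nat where k: "\<And>x. x \<ge> 0 \<Longrightarrow> \<bar>poly a x\<bar> \<le> real k * (x + 1) ^ d"
      by (rule poly_le_power[of a]) blast
    have "\<bar>poly2 (pCons a q) x y\<bar> \<le> real (k + c) * (x + y + 1) ^ (d + Suc e)" if "x \<ge> 0" "y \<ge> 0" for x y
    proof -
      let ?z = "x + y + 1"
      have z: "?z \<ge> 1" using that by simp
      have "\<bar>poly2 (pCons a q) x y\<bar> \<le> \<bar>poly a x\<bar> + y * \<bar>poly2 q x y\<bar>"
        using that abs_triangle_ineq[of "poly a x" "y * poly2 q x y"] by (simp add: poly2_def abs_mult)
      also have "\<dots> \<le> real k * ?z ^ (d + Suc e) + real c * ?z ^ (d + Suc e)"
      proof (rule add_mono)
        have "\<bar>poly a x\<bar> \<le> real k * (x + 1) ^ d" by (rule k[OF that(1)])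
        also have "\<dots> \<le> real k * ?z ^ d" using that by (intro mult_left_mono power_mono) simp_all
        also have "\<dots> \<le> real k * ?z ^ (d + Suc e)" using z by (intro mult_left_mono power_increasing) simp_all
        finally show "\<bar>poly a x\<bar> \<le> real k * ?z ^ (d + Suc e)" .
        have "y * \<bar>poly2 q x y\<bar> \<le> ?z * (real c * ?z ^ e)" using that by (intro mult_mono *) simp_all
        also have "\<dots> = real c * ?z ^ Suc e" by simp
        also have "\<dots> \<le> real c * ?z ^ (d + Suc e)" using z by (intro mult_left_mono power_increasing) simp_all
        finally show "y * \<bar>poly2 q x y\<bar> \<le> real c * ?z ^ (d + Suc e)" .
      qed
      also have "\<dots> = real (k + c) * ?z ^ (d + Suc e)" by (simp add: distrib_right)
      finally show ?thesis .
    qed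
    then show ?case by blast
  qed
  then show ?thesis using that by blast
qed

lemma poly_bounded_poly2:
  assumes "poly_bounded f"
  obtains q where "\<And>n \<epsilon>. \<epsilon> > 0 \<Longrightarrow> real (f n (nat \<lceil>1 / \<epsilon>\<rceil>)) \<le> poly2 q (real n) (1 / \<epsilon>)"
proof -
  obtain c e where f: "\<And>n m. f n m \<le> c * (n + m + 1) ^ e" using assms unfolding poly_bounded_def by blast
  \<comment> \<open>The base encodes (2 + x) + y; the 2 consists of the 1 already in the bound and
    the 1 lost in rounding 1 / \<epsilon> up.\<close>
  let ?q = "[:[:real c:]:] * [:[:2, 1:], 1:] ^ e"
  have q: "poly2 ?q x y = real c * (x + y + 2) ^ e" for x y
    by (simp add: poly2_def add_ac)
  have "real (f n (nat \<lceil>1 / \<epsilon>\<rceil>)) \<le> poly2 ?q (real n) (1 / \<epsilon>)" if "\<epsilon> > 0" for n \<epsilon>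
  proof -
    have "real (f n (nat \<lceil>1 / \<epsilon>\<rceil>)) \<le> real (c * (n + nat \<lceil>1 / \<epsilon>\<rceil> + 1) ^ e)"
      using f by (simp only: of_nat_le_iff)
    also have "\<dots> = real c * (real n + real (nat \<lceil>1 / \<epsilon>\<rceil>) + 1) ^ e" by (simp add: add_ac)
    also have "\<dots> \<le> real c * (real n + 1 / \<epsilon> + 2) ^ e"
    proof (intro mult_left_mono power_mono)
      have "0 < 1 / \<epsilon>" using that by simp
      then have "real (nat \<lceil>1 / \<epsilon>\<rceil>) \<le> 1 / \<epsilon> + 1" by linarith
      then show "real n + real (nat \<lceil>1 / \<epsilon>\<rceil>) + 1 \<le> real n + 1 / \<epsilon> + 2" by simp
    qed simp_all
    finally show ?thesis by (simp only: q)
  qed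
  then show ?thesis by (rule that)
qed

section \<open>Running time\<close>

definition rounds_bound :: "nat \<Rightarrow> nat \<Rightarrow> nat" where
  "rounds_bound n N = n * n * (2 * (N + 1)) * (2 * (N + 1))"

text \<open>Adds up all lower bounds required of b; a sum, unlike a maximum, is directly among the
  closure rules of \<open>poly_bounded\<close>.\<close>

definition num_bound :: "nat \<Rightarrow> nat \<Rightarrow> nat \<Rightarrow> nat" where
  "num_bound a n N = (let H = 2 * (N + 1); T = rounds_bound n N in
     (n * (T * (2 * a + H + 3) + 1 + (n * (T * (2 * a + H + 3) + 2) + 1) + a + 1) + 1) +
     2 * (T * (a + 2) + 1) + (T + 1) + (n + 1) + (H + 1))"

definition strat_bound :: "nat \<Rightarrow> nat \<Rightarrow> nat \<Rightarrow> nat" where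
  "strat_bound a n N = 2 + n * (2 + ((2 * num_bound a n N + 1) + (2 * num_bound a n N + 1)))"

definition call_bound :: "nat \<Rightarrow> (nat \<Rightarrow> nat) \<Rightarrow> nat \<Rightarrow> nat \<Rightarrow> nat" where
  "call_bound a r n N = a + r (strat_bound a n N)"

text \<open>The first summand makes room for the input, a pair of two numbers of size at most 2 b +
  1 each.\<close>

definition store_bound :: "nat \<Rightarrow> (nat \<Rightarrow> nat) \<Rightarrow> nat \<Rightarrow> nat \<Rightarrow> nat" where
  "store_bound a r n N = (4 * num_bound a n N + 3) + (2 + (rounds_bound n N + n) *
     (2 + (call_bound a r n N + (2 * num_bound a n N + 1) + (2 * num_bound a n N + 1))))"

definition time_bound :: "nat \<Rightarrow> (nat \<Rightarrow> nat) \<Rightarrow> nat \<Rightarrow> nat \<Rightarrow> nat" where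
  "time_bound a r n N =
     (9 + n * 3 + rounds_bound n N * (35 + n * 18 + rounds_bound n N * 5) + 1) *
     (1000 * store_bound a r n N + call_bound a r n N)"

lemma poly_bounded_time:
  "poly_bounded (\<lambda>n N. time_bound (c * (n + 1) ^ e) (\<lambda>m. d * (n + m + 1) ^ h) n N)"
  unfolding time_bound_def store_bound_def call_bound_def strat_bound_def num_bound_def
    rounds_bound_def Let_def
  by (intro poly_bounded_intros)

text \<open>A sparse list contains exactly the nonzero entries, so strict positivity of
  \<open>X\<close> on all rows and of \<open>Y\<close> on the played columns is what makes the
  outputs well formed.\<close>

lemma represents_enc:
  assumes "distinct is" "\<And>i. x i = (if i \<in> set is then real_of_rat (f i) else 0)"
    and "\<And>i. i \<in> set is \<Longrightarrow> f i \<noteq> 0"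
  shows "represents (enc f is) x"
  unfolding represents_def enc_def
  by (rule exI[of _ "map (\<lambda>i. (i, f i)) is"]) (use assms in \<open>auto simp: comp_def image_image\<close>)

text \<open>The exception is a program returning its input unchanged. Both procedures map a pair to
  a number, so it does not occur for them.\<close>

lemma computes_size:
  assumes "computes \<Gamma> c v k w" "w \<noteq> v"
  shows "val_size w \<le> k"
proof -
  obtain t where "exec \<Gamma> c (init_store v) k t" "t 0 = w" using assms(1) unfolding computes_def by blast
  then show ?thesis using exec_size[of \<Gamma> c "init_store v" k t 0] assms(2) by (simp add: init_store_def)
qed

lemma solver_correct:
  fixes r :: "nat \<Rightarrow> nat" and a :: nat
  defines "N \<equiv> \<lambda>\<epsilon>::real. nat \<lceil>1 / \<epsilon>\<rceil>"
  assumes \<alpha>: "\<alpha> \<ge> 1" and n: "n \<ge> 1" and J: "finite J" "J \<noteq> {}"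
    and pos: "\<forall>i<n. \<forall>j\<in>J. C i j > 0"
    and BR: "approx_best_responder \<alpha> {..<n} J C \<Gamma> f" and r: "\<And>m. f m \<le> real (r m)" "mono r"
    and PE: "payoff_evaluator {..<n} J C \<Gamma> g" and a: "g \<le> real a"
    and \<epsilon>: "\<epsilon> > 0"
  shows "\<exists>k v y. computes \<Gamma> (Seq solver_prog (Assign 0 (Var 17))) (solver_input n \<epsilon>) k v \<and>
      k \<le> time_bound a r n (N \<epsilon>) \<and> y \<in> mixed J \<and> represents v y \<and>
      (\<forall>x\<in>mixed {..<n}. expected_payoff {..<n} J C x y \<le> \<alpha> * (1 + \<epsilon>) * game_value {..<n} J C)" (is ?Y)
    and "\<exists>k v x. computes \<Gamma> (Seq solver_prog (Assign 0 (Var 16))) (solver_input n \<epsilon>) k v \<and>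
      k \<le> time_bound a r n (N \<epsilon>) \<and> x \<in> mixed {..<n} \<and> represents v x \<and>
      (\<forall>y\<in>mixed J. expected_payoff {..<n} J C x y \<ge> game_value {..<n} J C / (\<alpha> * (1 + \<epsilon>)))" (is ?X)
proof -
  define N' where "N' = N \<epsilon>"
  define H where "H = 2 * (N' + 1)"
  define T where T_rounds: "T = rounds_bound n N'"
  define b where "b = num_bound a n N'"
  define R where "R = call_bound a r n N'"
  define B where "B = store_bound a r n N'"
  \<comment> \<open>A rational preimage of the payoff exists for actual rows and columns because the
    evaluator outputs one; elsewhere the choice is arbitrary.\<close>
  define c where "c i j = (SOME q. real_of_rat q = C i j)" for i j
  have T_eq: "T = n * n * H * H" by (simp add: T_rounds H_def rounds_bound_def)
  have ceil: "rat_of_int \<lceil>1 / \<epsilon>\<rceil> = of_nat N'" using \<epsilon> by (simp add: N'_def N_def)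
  have input: "solver_input n \<epsilon> = Pair (Num (of_nat n)) (Num (of_nat N'))"
    unfolding solver_input_def ceil ..
  have N'_ge: "1 / \<epsilon> \<le> real N'" unfolding N'_def N_def by linarith
  have PE': "\<exists>k. computes \<Gamma> (\<Gamma> PayoffEval) (Pair (Num (of_nat i)) (Num (of_nat j))) k (Num (c i j)) \<and>
      C i j = real_of_rat (c i j) \<and> k \<le> a" if "i < n" "j \<in> J" for i j
  proof -
    obtain k q where kq: "computes \<Gamma> (\<Gamma> PayoffEval) (Pair (Num (of_nat i)) (Num (of_nat j))) k (Num q)"
      "real_of_rat q = C i j" "real k \<le> g"
      using PE \<open>i < n\<close> \<open>j \<in> J\<close> unfolding payoff_evaluator_def by blast
    have "real_of_rat (c i j) = C i j" unfolding c_def using kq(2) by (rule someI)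
    then have "c i j = q" using kq(2) by (metis of_rat_eq_iff)
    then show ?thesis using kq a by force
  qed
  have c_bits: "bits (c i j) \<le> a" if ij: "i < n" "j \<in> J" for i j
  proof -
    obtain k where "computes \<Gamma> (\<Gamma> PayoffEval) (Pair (Num (of_nat i)) (Num (of_nat j))) k (Num (c i j))" "k \<le> a"
      using PE'[OF ij] by blast
    then have "val_size (Num (c i j)) \<le> a" using computes_size by fastforce
    then show ?thesis using bits_le_rat_size[of "c i j"] by (simp add: val_size.simps)
  qed
  interpret positive_game n H J c C
  proof
    show "n \<ge> 1" "H \<ge> 2" "finite J" "J \<noteq> {}" using n J by (simp_all add: H_def)
    fix i j assume ij: "i < n" "j \<in> J"
    show "C i j = real_of_rat (c i j)" using PE'[OF ij] by blast
    then show "c i j > 0" using pos ij by (metis zero_less_of_rat_iff)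
  qed
  have b_ge: "b \<ge> n * (T * (2 * a + H + 3) + 1 + (n * (T * (2 * a + H + 3) + 2) + 1) + a + 1) + 1"
      "b \<ge> 2 * (T * (a + 2) + 1)" "b \<ge> T + 1" "b \<ge> n + 1" "b \<ge> H + 1"
    unfolding b_def num_bound_def Let_def T_rounds[symmetric] H_def[symmetric] by simp_all
  have rep_x: "represents (enc (X js) ls) (strat_x js)"
    if "set js \<subseteq> J" "distinct ls" "set ls = {..<n}" for js ls
    using that X_pos[OF that(1)] by (intro represents_enc) (force simp: strat_x_def)+
  interpret mw_sizes n H J c N' T a b
    by unfold_locales (use H_def T_eq b_ge c_bits in simp_all)
  interpret solver n H J c \<Gamma> B R N' T a b "good \<alpha>"
  proof
    show "B \<ge> 3" unfolding B_def store_bound_def by simp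
    show "B \<ge> 2 + (T + n) * (2 + (R + (2 * b + 1) + (2 * b + 1)))"
      unfolding B_def store_bound_def T_rounds R_def b_def by simp
    fix i j assume "i < n" "j \<in> J"
    show "\<exists>k. computes \<Gamma> (\<Gamma> PayoffEval) (Pair (Num (of_nat i)) (Num (of_nat j))) k (Num (c i j)) \<and> k \<le> R"
      using PE'[OF \<open>i < n\<close> \<open>j \<in> J\<close>] unfolding R_def call_bound_def by fastforce
  next
    fix js ls assume js: "set js \<subseteq> J" "length js < T" "distinct ls" "set ls = {..<n}"
    have size: "val_size (enc (X js) ls) \<le> strat_bound a n N'"
      using val_size_X[OF js(1) less_imp_le[OF js(2)] js(3,4)] unfolding strat_bound_def b_def .
    obtain k j where kj: "computes \<Gamma> (\<Gamma> BestResponse) (enc (X js) ls) k (Num (of_nat j))" "j \<in> J"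
      "payoff (strat_x js) (pure_strategy j) \<le> \<alpha> * best (strat_x js)"
      "real k \<le> f (val_size (enc (X js) ls))"
      using BR strat_x_mixed[OF js(1)] rep_x[OF js(1,3,4)] unfolding approx_best_responder_def by blast
    have "real k \<le> real (r (val_size (enc (X js) ls)))" using kj(4) r(1) by (rule order_trans)
    then have "k \<le> r (strat_bound a n N')" using monoD[OF r(2) size] by simp
    then have "k \<le> R" unfolding R_def call_bound_def by simp
    \<comment> \<open>A strategy on at least one row is encoded as a pair, hence differs from the
      oracle's numeric answer, and the answer is as short as the call.\<close>
    moreover have "0 \<in> set ls" using js(4) n by simp
    then have "Num (of_nat j) \<noteq> enc (X js) ls" by (cases ls) auto
    then have "val_size (Num (of_nat j)) \<le> k" by (rule computes_size[OF kj(1)])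
    ultimately show "\<exists>k j. computes \<Gamma> (\<Gamma> BestResponse) (enc (X js) ls) k (Num (of_nat j)) \<and> k \<le> R \<and>
          val_size (Num (of_nat j)) \<le> R \<and> j \<in> J \<and> good \<alpha> js j"
      using kj unfolding good_def by (intro exI[of _ k] exI[of _ j]) simp
  qed
  let ?s = "init_store (solver_input n \<epsilon>)"
  have s_input: "val_size (solver_input n \<epsilon>) \<le> B"
  proof -
    have "val_size (Num (of_nat n)) \<le> 2 * b + 1" by (rule num_nat_le[OF b_ge(4)])
    moreover have "val_size (Num (of_nat N')) \<le> 2 * b + 1" using b_ge(5) by (intro num_nat_le) (simp add: H_def)
    ultimately show ?thesis unfolding input B_def store_bound_def b_def by simp
  qed
  have s: "sized B ?s" "?s 0 = Pair (Num (of_nat n)) (Num (of_nat N'))" "\<And>x. x \<noteq> 0 \<Longrightarrow> ?s x = Num 0"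
    using s_input B_ge by (simp_all add: sized_def init_store_def input)
  have out: "\<exists>k t. computes \<Gamma> (Seq solver_prog (Assign 0 (Var x))) (solver_input n \<epsilon>) k (t x) \<and>
      k \<le> time_bound a r n N' \<and> solved t" for x
  proof -
    have "wp (Seq solver_prog (Assign 0 (Var x))) ?s
        ((9 + n * 3 + T * (35 + n * 18 + T * 5)) + 1) (\<lambda>t'. \<exists>t. t' 0 = t x \<and> solved t)"
    proof (rule wp_Seq, rule wp_conseq[OF wp_solver le_refl])
      fix t assume "solved t \<and> sized B t"
      then show "wp (Assign 0 (Var x)) t 1 (\<lambda>t'. \<exists>t. t' 0 = t x \<and> solved t)"
        by (intro wp_Assign) (auto simp: cost_factor_def)
    qed (rule s)+
    then obtain k t' t where kt: "exec \<Gamma> (Seq solver_prog (Assign 0 (Var x))) ?s k t'" "t' 0 = t x" "solved t"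
      and k: "k \<le> ((9 + n * 3 + T * (35 + n * 18 + T * 5)) + 1) * (1000 * B + R)"
      unfolding wp_def by (elim exE conjE) (rule that)
    have "k \<le> time_bound a r n N'" using k unfolding time_bound_def T_rounds B_def R_def .
    then show ?thesis using kt unfolding computes_def by blast
  qed
  show ?Y
  proof -
    obtain k t where kt: "computes \<Gamma> (Seq solver_prog (Assign 0 (Var 17))) (solver_input n \<epsilon>) k (t 17)"
      "k \<le> time_bound a r n N'" "solved t" using out by blast
    obtain js ks where js: "length js = T" "set js \<subseteq> J" "\<forall>(js', j)\<in>rounds js. good \<alpha> js' j"
      "distinct ks" "set ks = set js" "t 17 = enc (\<lambda>k. Y js k / D js) ks"
      using kt(3) unfolding solved_def by (elim exE conjE) (rule that)
    have ne: "js \<noteq> []" using js(1) T_pos by auto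
    have "represents (t 17) (strat_y js)"
      unfolding js(6) using js(2,5) Y_pos[OF js(2)] D_pos[OF js(2) ne] Y_eq_0[of _ js]
      by (intro represents_enc js(4)) (force simp: strat_y_def)+
    moreover have "payoff x (strat_y js) \<le> \<alpha> * (1 + \<epsilon>) * game_value {..<n} J C" if "x \<in> mixed {..<n}" for x
      by (rule strat_y_guarantee[OF js(2) _ H_def N'_ge \<epsilon> \<alpha> _ that]) (use js(1,3) T_eq in auto)
    ultimately show ?thesis
      using kt(1,2) strat_y_mixed[OF js(2) ne] unfolding N'_def by blast
  qed
  show ?X
  proof -
    obtain k t where kt: "computes \<Gamma> (Seq solver_prog (Assign 0 (Var 16))) (solver_input n \<epsilon>) k (t 16)"
      "k \<le> time_bound a r n N'" "solved t" using out by blast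
    obtain js ls js0 j0 where js: "length js = T" "set js \<subseteq> J" "\<forall>(js', j)\<in>rounds js. good \<alpha> js' j"
      "(js0, j0) \<in> rounds js" "\<forall>(js', j)\<in>rounds js. V js' j \<le> V js0 j0"
      "distinct ls" "set ls = {..<n}" "t 16 = enc (X js0) ls"
      using kt(3) unfolding solved_def by (elim exE conjE) (rule that)
    have js0: "set js0 \<subseteq> J" using rounds_set[OF js(4)] js(2) by auto
    have "represents (t 16) (strat_x js0)" unfolding js(8) by (rule rep_x[OF js0 js(6,7)])
    moreover have "game_value {..<n} J C / (\<alpha> * (1 + \<epsilon>)) \<le> payoff (strat_x js0) y" if "y \<in> mixed J" for y
      by (rule strat_x_guarantee[OF js(2) _ H_def N'_ge \<epsilon> \<alpha> _ js(4) _ that]) (use js(1,3,4,5) T_eq in auto)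
    ultimately show ?thesis
      using kt(1,2) strat_x_mixed[OF js0] unfolding N'_def by blast
  qed
qed

theorem theorem2:
  fixes p rE :: "real poly" and rB :: "real poly poly"
  shows "\<exists>(Ay :: com) (Ax :: com) (qy :: real poly poly) (qx :: real poly poly poly).
    \<forall>(\<alpha> :: real) (n :: nat) (J :: nat set) (C :: nat \<Rightarrow> nat \<Rightarrow> real)
      (\<Gamma> :: proc_name \<Rightarrow> com) (\<epsilon> :: real).
      \<alpha> \<ge> 1 \<longrightarrow> n \<ge> 1 \<longrightarrow>
      finite J \<longrightarrow> J \<noteq> {} \<longrightarrow> real (card J) \<le> 2 powr poly p (real n) \<longrightarrow>
      (\<forall>i<n. \<forall>j\<in>J. C i j > 0) \<longrightarrow>
      approx_best_responder \<alpha> {..<n} J C \<Gamma> (\<lambda>m. poly2 rB (real n) (real m)) \<longrightarrow>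
      payoff_evaluator {..<n} J C \<Gamma> (poly rE (real n)) \<longrightarrow>
      \<epsilon> > 0 \<longrightarrow>
      (\<exists>k v y. computes \<Gamma> Ay (solver_input n \<epsilon>) k v \<and>
         real k \<le> poly2 qy (real n) (1 / \<epsilon>) \<and>
         y \<in> mixed J \<and> represents v y \<and>
         (\<forall>x \<in> mixed {..<n}. expected_payoff {..<n} J C x y
            \<le> \<alpha> * (1 + \<epsilon>) * game_value {..<n} J C)) \<and>
      (\<exists>k v x. computes \<Gamma> Ax (solver_input n \<epsilon>) k v \<and>
         real k \<le> poly3 qx (real n) (1 / \<epsilon>) \<alpha> \<and>
         x \<in> mixed {..<n} \<and> represents v x \<and>
         (\<forall>y \<in> mixed J. expected_payoff {..<n} J C x y
            \<ge> game_value {..<n} J C / (\<alpha> * (1 + \<epsilon>))))"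
proof -
  obtain c e where c: "\<And>x. x \<ge> 0 \<Longrightarrow> \<bar>poly rE x\<bar> \<le> real c * (x + 1) ^ e"
    by (rule poly_le_power[of rE]) blast
  obtain d h where d: "\<And>x y. x \<ge> 0 \<Longrightarrow> y \<ge> 0 \<Longrightarrow> \<bar>poly2 rB x y\<bar> \<le> real d * (x + y + 1) ^ h"
    by (rule poly2_le_power[of rB]) blast
  \<comment> \<open>These bounds depend only on n and the given polynomials, so that q can be fixed
    before the game, the procedures and the accuracy.\<close>
  define a where "a n = c * (n + 1) ^ e" for n
  define r where "r n m = d * (n + m + 1) ^ h" for n m
  have a: "poly rE (real n) \<le> real (a n)" for n
    using c[of "real n"] by (simp add: a_def add.commute)
  have r: "poly2 rB (real n) (real m) \<le> real (r n m)" for n m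
    using d[of "real n" "real m"] by (simp add: r_def add_ac)
  have mono: "mono (r n)" for n
    unfolding r_def by (intro monoI mult_left_mono power_mono) simp_all
  obtain q where q: "\<And>n \<epsilon>. \<epsilon> > 0 \<Longrightarrow> real (time_bound (a n) (r n) n (nat \<lceil>1 / \<epsilon>\<rceil>)) \<le> poly2 q (real n) (1 / \<epsilon>)"
    using poly_bounded_poly2[OF poly_bounded_time[of c e d h]] unfolding a_def r_def by blast
  \<comment> \<open>Both algorithms obey the bound q, read for Player I as a polynomial constant in
    \<alpha>.\<close>
  have poly3_const: "poly3 [:q:] x y z = poly2 q x y" for x y z by (simp add: poly3_def)
  show ?thesis
  proof (rule exI[of _ "Seq solver_prog (Assign 0 (Var 17))"],
      rule exI[of _ "Seq solver_prog (Assign 0 (Var 16))"], rule exI[of _ q], rule exI[of _ "[:q:]"],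
      intro allI impI, unfold poly3_const, rule conjI, goal_cases)
    case (1 \<alpha> n J C \<Gamma> \<epsilon>)
    from solver_correct(1)[OF 1(1-4,6,7) r mono 1(8) a 1(9)] q[OF 1(9), of n]
    show ?case by (meson order_trans of_nat_mono)
  next
    case (2 \<alpha> n J C \<Gamma> \<epsilon>)
    from solver_correct(2)[OF 2(1-4,6,7) r mono 2(8) a 2(9)] q[OF 2(9), of n]
    show ?case by (meson order_trans of_nat_mono)
  qed
qed

end
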